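(* For $j\in\{1,2,3,4\}$ let $\phi_j(n)=\frac{1}{v(SG(n))}\sum_{x\in V(SG(n))}F_j(n,x)$, where $F_j(n,x)$ is the fraction of spanning trees of the Sierpinski gasket graph $SG(n)$ in which the vertex $x$ has degree exactly $j$, and $v(SG(n))=\frac32(3^n+1)$ is the number of vertices. Then the limits $\phi_j=\lim_{n\to\infty}\phi_j(n)$ are $$\phi_1=\frac{10957}{40464},\qquad \phi_2=\frac{6626035}{13636368},\qquad \phi_3=\frac{2943139}{13636368},\qquad \phi_4=\frac{124895}{4545456}.$$
   Context: The two-dimensional Sierpinski gasket graph $SG(n)$, $n\ge 0$, is drawn in the plane with three outmost vertices: leftmost, rightmost and topmost. $SG(0)$ is a triangle (3 vertices, 3 edges). $SG(n+1)$ consists of three copies of $SG(n)$ (lower-left, lower-right, top), where the rightmost vertex of the lower-left copy is identified with the leftmost vertex of the lower-right copy, the topmost vertex of the lower-left copy with the leftmost vertex of the top copy, and the topmost vertex of the lower-right copy with the rightmost vertex of the top copy. It has $3^{n+1}$ edges and $\frac32(3^n+1)$ vertices. All spanning trees are weighted equally. $f(n)$ is the number of spanning trees of $SG(n)$, $f_j(n,x)$ is the number of spanning trees of $SG(n)$ in which exactly $j$ tree edges are incident to $x$, and $F_j(n,x)=f_j(n,x)/f(n)$. *)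

theory Defs
  imports Complex_Main "HOL-Library.Product_Plus"
begin

section \<open>Spanning trees of finite simple graphs\<close>

text \<open>
  A simple graph is given by its vertex set and its set of edges, each edge being a two-element
  set of vertices. A spanning tree is identified with its edge set.
\<close>

definition adjacency :: "'a set set \<Rightarrow> ('a \<times> 'a) set" where
  "adjacency E = {(u, v). {u, v} \<in> E}"

definition connected_graph :: "'a set \<Rightarrow> 'a set set \<Rightarrow> bool" where
  "connected_graph V E \<longleftrightarrow> V \<noteq> {} \<and> (\<forall>u\<in>V. \<forall>v\<in>V. (u, v) \<in> (adjacency E)\<^sup>*)"

definition graph_cycle :: "'a set set \<Rightarrow> 'a list \<Rightarrow> bool" where
  "graph_cycle E p \<longleftrightarrow> 3 \<le> length p \<and> distinct p \<and>
     (\<forall>i<length p. {p ! i, p ! (Suc i mod length p)} \<in> E)"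

definition spanning_tree :: "'a set \<Rightarrow> 'a set set \<Rightarrow> 'a set set \<Rightarrow> bool" where
  "spanning_tree V E T \<longleftrightarrow> T \<subseteq> E \<and> connected_graph V T \<and> (\<nexists>p. graph_cycle T p)"

definition degree_in :: "'a set set \<Rightarrow> 'a \<Rightarrow> nat" where
  "degree_in T x = card {e \<in> T. x \<in> e}"


section \<open>The Sierpinski gasket graphs\<close>

text \<open>
  The pair \<open>(a, b)\<close> stands for the point \<open>a *\<^sub>R (1, 0) + b *\<^sub>R (1/2, sqrt 3 / 2)\<close> of the plane, so
  the leftmost, rightmost and topmost vertices of \<open>SG(n)\<close> are \<open>(0, 0)\<close>, \<open>(2 ^ n, 0)\<close> and
  \<open>(0, 2 ^ n)\<close>. The three copies making up \<open>SG(n + 1)\<close> are translates, and the prescribed vertex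
  identifications are coincidences of points; by the lemmas \<open>sg_copies_Int\<close> below
  there are no others.
\<close>

fun sg_verts :: "nat \<Rightarrow> (nat \<times> nat) set" where
  "sg_verts 0 = {(0, 0), (1, 0), (0, 1)}"
| "sg_verts (Suc n) =
     sg_verts n \<union> (+) (2 ^ n, 0) ` sg_verts n \<union> (+) (0, 2 ^ n) ` sg_verts n"

fun sg_edges :: "nat \<Rightarrow> (nat \<times> nat) set set" where
  "sg_edges 0 = {{(0, 0), (1, 0)}, {(0, 0), (0, 1)}, {(1, 0), (0, 1)}}"
| "sg_edges (Suc n) =
     sg_edges n \<union> (`) ((+) (2 ^ n, 0)) ` sg_edges n \<union> (`) ((+) (0, 2 ^ n)) ` sg_edges n"

lemma finite_sg_verts: "finite (sg_verts n)"
  by (induction n) auto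

lemma finite_sg_edges: "finite (sg_edges n)"
  by (induction n) auto

lemma sg_corners: "(0, 0) \<in> sg_verts n" "(2 ^ n, 0) \<in> sg_verts n" "(0, 2 ^ n) \<in> sg_verts n"
proof (induction n)
  case (Suc n)
  {
    case 1 then show ?case using Suc by simp
  next
    case 2
    have "(2 ^ Suc n, 0) = (2 ^ n, 0) + ((2 ^ n, 0) :: nat \<times> nat)" by simp
    then show ?case using Suc(2) by (metis UnI1 UnI2 imageI sg_verts.simps(2))
  next
    case 3
    have "(0, 2 ^ Suc n) = (0, 2 ^ n) + ((0, 2 ^ n) :: nat \<times> nat)" by simp
    then show ?case using Suc(3) by (metis UnI2 imageI sg_verts.simps(2))
  }
qed auto

lemma sg_verts_le: "(a, b) \<in> sg_verts n \<Longrightarrow> a + b \<le> 2 ^ n"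
  by (induction n arbitrary: a b) fastforce+

lemma sg_copies_Int:
  "sg_verts n \<inter> (+) (2 ^ n, 0) ` sg_verts n = {(2 ^ n, 0)}"
  "sg_verts n \<inter> (+) (0, 2 ^ n) ` sg_verts n = {(0, 2 ^ n)}"
  "(+) (2 ^ n, 0) ` sg_verts n \<inter> (+) (0, 2 ^ n) ` sg_verts n = {(2 ^ n, 2 ^ n)}"
proof -
  have c: "(2 ^ n, 0) = (2 ^ n, 0) + ((0, 0) :: nat \<times> nat)"
    "(0, 2 ^ n) = (0, 2 ^ n) + ((0, 0) :: nat \<times> nat)"
    "(2 ^ n, 2 ^ n) = (2 ^ n, 0) + ((0, 2 ^ n) :: nat \<times> nat)"
    "(2 ^ n, 2 ^ n) = (0, 2 ^ n) + ((2 ^ n, 0) :: nat \<times> nat)" by simp_all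
  show "sg_verts n \<inter> (+) (2 ^ n, 0) ` sg_verts n = {(2 ^ n, 0)}"
  proof (intro equalityI subsetI)
    show "x \<in> {(2 ^ n, 0)}" if "x \<in> sg_verts n \<inter> (+) (2 ^ n, 0) ` sg_verts n" for x
      using that by (auto dest!: sg_verts_le)
  qed (use sg_corners[of n] c in \<open>metis IntI imageI singletonD\<close>)
  show "sg_verts n \<inter> (+) (0, 2 ^ n) ` sg_verts n = {(0, 2 ^ n)}"
  proof (intro equalityI subsetI)
    show "x \<in> {(0, 2 ^ n)}" if "x \<in> sg_verts n \<inter> (+) (0, 2 ^ n) ` sg_verts n" for x
      using that by (auto dest!: sg_verts_le)
  qed (use sg_corners[of n] c in \<open>metis IntI imageI singletonD\<close>)
  show "(+) (2 ^ n, 0) ` sg_verts n \<inter> (+) (0, 2 ^ n) ` sg_verts n = {(2 ^ n, 2 ^ n)}"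
  proof (intro equalityI subsetI)
    show "x \<in> {(2 ^ n, 2 ^ n)}"
      if "x \<in> (+) (2 ^ n, 0) ` sg_verts n \<inter> (+) (0, 2 ^ n) ` sg_verts n" for x
      using that by (auto dest!: sg_verts_le)
  qed (use sg_corners[of n] c in \<open>metis IntI imageI singletonD\<close>)
qed

lemma card_Un3:
  assumes "finite A" "finite B" "finite C"
  shows "card (A \<union> B \<union> C) + card (A \<inter> B) + card (A \<inter> C) + card (B \<inter> C) =
    card A + card B + card C + card (A \<inter> B \<inter> C)"
proof -
  have "card (A \<union> B) + card (A \<inter> B) = card A + card B"
    using card_Un_Int[of A B] assms by simp
  moreover have "card (A \<union> B \<union> C) + card ((A \<union> B) \<inter> C) = card (A \<union> B) + card C"
    using card_Un_Int[of "A \<union> B" C] assms by simp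
  moreover have "card ((A \<union> B) \<inter> C) + card (A \<inter> B \<inter> C) = card (A \<inter> C) + card (B \<inter> C)"
    using card_Un_Int[of "A \<inter> C" "B \<inter> C"] assms by (simp add: Int_Un_distrib Int_Un_distrib2 Int_ac)
  ultimately show ?thesis by linarith
qed

lemma card_sg_verts: "real (card (sg_verts n)) = 3 / 2 * (3 ^ n + 1)"
proof (induction n)
  case (Suc n)
  let ?A = "sg_verts n" and ?B = "(+) (2 ^ n, 0) ` sg_verts n" and ?C = "(+) (0, 2 ^ n) ` sg_verts n"
  have "?A \<inter> ?B \<inter> ?C = {}"
    using sg_copies_Int(1,2)[of n] by auto
  then have "card (sg_verts (Suc n)) + 3 = 3 * card (sg_verts n)"
    using card_Un3[of ?A ?B ?C] finite_sg_verts[of n] sg_copies_Int[of n]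
    by (simp add: card_image)
  then have "real (card (sg_verts (Suc n))) + 3 = 3 * real (card (sg_verts n))"
    by linarith
  then show ?case using Suc by simp
qed auto

lemma sg_edges_wf: "e \<in> sg_edges n \<Longrightarrow> e \<subseteq> sg_verts n \<and> card e = 2"
proof (induction n arbitrary: e)
  case (Suc n)
  then show ?case by (auto simp: card_image dest!: Suc.IH)
qed auto

lemma card_sg_edges: "card (sg_edges n) = 3 ^ (n + 1)"
proof (induction n)
  case 0
  show ?case by (simp add: doubleton_eq_iff)
next
  case (Suc n)
  let ?A = "sg_edges n" and ?B = "(`) ((+) (2 ^ n, 0)) ` sg_edges n"
    and ?C = "(`) ((+) (0, 2 ^ n)) ` sg_edges n"
  let ?VB = "(+) (2 ^ n, 0) ` sg_verts n" and ?VC = "(+) (0, 2 ^ n) ` sg_verts n"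
  have wfB: "e \<subseteq> ?VB" if "e \<in> ?B" for e using that sg_edges_wf[of _ n] by blast
  have wfC: "e \<subseteq> ?VC" if "e \<in> ?C" for e using that sg_edges_wf[of _ n] by blast
  have two: "card e = 2" if "e \<in> ?A \<union> ?B \<union> ?C" for e
    using that sg_edges_wf[of e "Suc n"] by simp
  have one: "card e \<noteq> 2" if "e \<subseteq> {x}" for e :: "(nat \<times> nat) set" and x
    using card_mono[OF _ that] by auto
  have "?A \<inter> ?B = {}"
  proof -
    have "False" if "e \<in> ?A" "e \<in> ?B" for e
      using that one[of e "(2 ^ n, 0)"] two[of e] wfB[of e] sg_edges_wf[of e n] sg_copies_Int(1)[of n]
      by blast
    then show ?thesis by blast
  qed
  moreover have "?A \<inter> ?C = {}"
  proof -
    have "False" if "e \<in> ?A" "e \<in> ?C" for e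
      using that one[of e "(0, 2 ^ n)"] two[of e] wfC[of e] sg_edges_wf[of e n] sg_copies_Int(2)[of n]
      by blast
    then show ?thesis by blast
  qed
  moreover have "?B \<inter> ?C = {}"
  proof -
    have "False" if "e \<in> ?B" "e \<in> ?C" for e
      using that one[of e "(2 ^ n, 2 ^ n)"] two[of e] wfB[of e] wfC[of e] sg_copies_Int(3)[of n]
      by blast
    then show ?thesis by blast
  qed
  moreover have "inj_on ((`) ((+) c)) (sg_edges n)" for c :: "nat \<times> nat"
    by (rule inj_onI) (simp add: inj_image_eq_iff)
  ultimately show ?case
    using card_Un3[of ?A ?B ?C] finite_sg_edges[of n] Suc
    by (simp add: card_image)
qed


section \<open>Degree distribution of a uniform spanning tree\<close>

definition sg_trees :: "nat \<Rightarrow> (nat \<times> nat) set set set" where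
  "sg_trees n = {T. spanning_tree (sg_verts n) (sg_edges n) T}"

definition sg_f :: "nat \<Rightarrow> nat" where
  "sg_f n = card (sg_trees n)"

definition sg_f_deg :: "nat \<Rightarrow> nat \<Rightarrow> nat \<times> nat \<Rightarrow> nat" where
  "sg_f_deg j n x = card {T \<in> sg_trees n. degree_in T x = j}"

definition sg_F :: "nat \<Rightarrow> nat \<Rightarrow> nat \<times> nat \<Rightarrow> real" where
  "sg_F j n x = real (sg_f_deg j n x) / real (sg_f n)"

definition sg_phi :: "nat \<Rightarrow> nat \<Rightarrow> real" where
  "sg_phi j n = 1 / real (card (sg_verts n)) * (\<Sum>x\<in>sg_verts n. sg_F j n x)"

end

theory Submission
  imports Defs "HOL-Library.FuncSet"
begin

text \<open>
  Call a forest of \<open>SG(n)\<close> in which every vertex is connected to one of the three corners a forest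
  of pattern \<open>\<tau>\<close>, where \<open>\<tau>\<close> is the partition of the corners into components. Cutting \<open>SG(n + 1)\<close>
  into its three copies of \<open>SG(n)\<close> cuts a forest of pattern \<open>\<tau>\<close> into three such forests, and a
  triple of patterns determines whether three forests glue to a forest of pattern \<open>\<tau>\<close>. The
  numbers of forests of the three kinds of patterns are in the proportion \<open>1 : r : 3 r\<^sup>2\<close> with
  \<open>r = (5/3)^n / 3\<close>, so after normalisation all recursions have constant coefficients.

  The degree distributions of the corners satisfy a homogeneous linear recursion with the eigenvalues
  \<open>1, 1/15, 3/5, 1/25\<close>. A vertex that is not a corner is, at a unique level, the joint of two copies,
  and there its degree is the sum of the degrees of two corners. Hence the sums over the inner
  vertices satisfy a linear recursion with the dominant eigenvalue 3 and a forcing term that is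
  quadratic in the corner distributions; pairing with the left eigenvector leaves a sum of geometric
  series.
\<close>

section \<open>Spanning trees and edge counts\<close>

text \<open>The limit concerns spanning trees, the pattern \<open>Joined\<close>, but cutting
  produces all five patterns, so every count is carried for all of them. The obstacle is acyclicity,
  which is not local: a cycle may run through all three copies. It is replaced by an edge count,
  which adds up over edge-disjoint copies. Edges that connect every vertex to a corner number at
  least \<open>card V - blocks \<tau>\<close>, and the forests are the sets that attain this bound.
  The bounds for the copies and the bound on the blocks of a gluing add up to the bound for the
  whole, so they are all equalities together. The proportion 1 : r : 3 r^2 survives a step because
  the weighted numbers of admissible triples are 6, 10 and 50, where 10/6 = 5/3 and 50/6 = 3
  (5/3)^2. Pairing with the left eigenvector controls only a weighted mean over the patterns. This
  determines the value for \<open>Joined\<close> because the values of different patterns drift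
  apart at most linearly in n, which is negligible against 3^n.\<close>

abbreviation conn :: "'a set set \<Rightarrow> 'a \<Rightarrow> 'a \<Rightarrow> bool" where
  "conn T u v \<equiv> (u, v) \<in> (adjacency T)\<^sup>*"

lemma adjacency_iff [simp]: "(u, v) \<in> adjacency T \<longleftrightarrow> {u, v} \<in> T"
  by (simp add: adjacency_def)

lemma conn_sym: "conn T u v \<Longrightarrow> conn T v u"
proof -
  have "sym (adjacency T)" by (auto simp: sym_def insert_commute)
  then show "conn T u v \<Longrightarrow> conn T v u" by (meson sym_rtrancl symD)
qed

lemma conn_mono: "conn T u v \<Longrightarrow> T \<subseteq> T' \<Longrightarrow> conn T' u v"
  by (rule subsetD[OF rtrancl_mono]) (auto simp: adjacency_def)

lemma conn_edge: "{u, v} \<in> T \<Longrightarrow> conn T u v"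
  by (rule r_into_rtrancl) simp

text \<open>A breadth-first forest: every vertex outside \<open>S\<close> picks an edge to a vertex
  strictly closer to \<open>S\<close>. Two vertices picking the same edge would each be closer than
  the other, hence injectivity. The last conclusion is conditional because parents must stay in
  \<open>V\<close> for the induction on the distance.\<close>

lemma parent_edges:
  assumes reach: "\<And>v. v \<in> V \<Longrightarrow> \<exists>s\<in>S. conn T s v"
  obtains g where "inj_on g (V - S)" "g ` (V - S) \<subseteq> T"
    "(\<And>e. e \<in> T \<Longrightarrow> e \<subseteq> V) \<Longrightarrow> \<forall>v\<in>V. \<exists>s\<in>S. conn (g ` (V - S)) s v"
proof -
  define walk where "walk k v \<longleftrightarrow> (\<exists>s\<in>S. (s, v) \<in> adjacency T ^^ k)" for k v
  define d where "d v = (LEAST k. walk k v)" for v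
  have dI: "d v \<le> k" if "walk k v" for v k using that unfolding d_def by (rule Least_le)
  have "\<exists>u. {u, v} \<in> T \<and> d u < d v" if v: "v \<in> V - S" for v
  proof -
    have "\<exists>k. walk k v" using reach[of v] v unfolding walk_def by (meson DiffD1 rtrancl_imp_relpow)
    then have "walk (d v) v" unfolding d_def by (rule LeastI_ex)
    then obtain s where s: "s \<in> S" "(s, v) \<in> adjacency T ^^ d v" unfolding walk_def by blast
    with v obtain k where k: "d v = Suc k" by (cases "d v") auto
    with s obtain u where "(s, u) \<in> adjacency T ^^ k" "{u, v} \<in> T" by auto
    then show ?thesis using s(1) dI[of k u] k unfolding walk_def by (metis le_imp_less_Suc)
  qed
  then obtain par where par: "\<And>v. v \<in> V - S \<Longrightarrow> {par v, v} \<in> T \<and> d (par v) < d v" by metis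
  define g where "g v = {par v, v}" for v
  have "inj_on g (V - S)"
  proof (rule inj_onI)
    fix v w assume "v \<in> V - S" "w \<in> V - S" "g v = g w"
    then show "v = w" using par[of v] par[of w] unfolding g_def doubleton_eq_iff
      by (metis less_asym)
  qed
  moreover have "g ` (V - S) \<subseteq> T" using par by (auto simp: g_def)
  moreover have "\<forall>v\<in>V. \<exists>s\<in>S. conn (g ` (V - S)) s v" if sub: "\<And>e. e \<in> T \<Longrightarrow> e \<subseteq> V"
  proof
    fix v assume "v \<in> V"
    then show "\<exists>s\<in>S. conn (g ` (V - S)) s v"
    proof (induction "d v" arbitrary: v rule: less_induct)
      case less
      show ?case
      proof (cases "v \<in> S")
        case False
        then have v: "v \<in> V - S" using less.prems by simp
        obtain s where s: "s \<in> S" "conn (g ` (V - S)) s (par v)"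
          using less.hyps[of "par v"] par[OF v] sub by blast
        have "{par v, v} \<in> g ` (V - S)" using v unfolding g_def by blast
        then have "conn (g ` (V - S)) s v" using s(2) conn_edge by (metis rtrancl_trans)
        then show ?thesis using s(1) by blast
      qed auto
    qed
  qed
  ultimately show thesis by (rule that)
qed

lemma card_le_card_roots_plus_edges:
  assumes "\<And>v. v \<in> V \<Longrightarrow> \<exists>s\<in>S. conn T s v" "finite S" "finite T"
  shows "card V \<le> card S + card T"
proof -
  obtain g where "inj_on g (V - S)" "g ` (V - S) \<subseteq> T" by (rule parent_edges[of V S T]) (use assms(1) in auto)
  then have "card (V - S) \<le> card T" using card_inj_on_le assms(3) by blast
  moreover have "card V - card S \<le> card (V - S)" by (rule diff_card_le_card_Diff[OF assms(2)])
  ultimately show ?thesis by linarith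
qed

lemma rtrancl_imp_distinct_path:
  assumes "(u, v) \<in> r\<^sup>*"
  shows "\<exists>p. p \<noteq> [] \<and> distinct p \<and> hd p = u \<and> last p = v \<and> successively (\<lambda>x y. (x, y) \<in> r) p"
  using assms
proof (induction rule: rtrancl_induct)
  case base
  show ?case by (rule exI[of _ "[u]"]) simp
next
  case (step y z)
  then obtain p where p: "p \<noteq> []" "distinct p" "hd p = u" "last p = y"
    "successively (\<lambda>x y. (x, y) \<in> r) p" by blast
  show ?case
  proof (cases "z \<in> set p")
    case True
    then obtain a b where ab: "p = a @ z # b" by (meson split_list)
    show ?thesis
      by (rule exI[of _ "a @ [z]"]) (use p ab in \<open>auto simp: successively_append_iff hd_append\<close>)
  next
    case False
    show ?thesis
      by (rule exI[of _ "p @ [z]"]) (use p False step.hyps in \<open>auto simp: successively_append_iff\<close>)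
  qed
qed

text \<open>Adding the edge closes a path from \<open>u\<close> to \<open>v\<close>. Since
  \<open>graph_cycle\<close> demands three vertices, \<open>u \<noteq> v\<close> serves to exclude a
  path with one vertex and \<open>{u, v} \<notin> T\<close> a path with two.\<close>

lemma non_edge_closes_cycle:
  assumes "conn T u v" "u \<noteq> v" "{u, v} \<notin> T"
  shows "\<exists>p. graph_cycle (insert {u, v} T) p"
proof -
  obtain p where p: "p \<noteq> []" "distinct p" "hd p = u" "last p = v"
    "successively (\<lambda>x y. (x, y) \<in> adjacency T) p"
    using rtrancl_imp_distinct_path[OF assms(1)] by blast
  have edge: "{p ! i, p ! Suc i} \<in> T" if "Suc i < length p" for i
    using p(5) that by (simp add: successively_conv_nth)
  have ends: "p ! 0 = u" "p ! (length p - 1) = v"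
    using p by (simp_all add: hd_conv_nth last_conv_nth)
  have "length p \<noteq> 1" using ends assms(2) by auto
  moreover have "length p \<noteq> 2"
    using ends edge[of 0] assms(3) by auto
  ultimately have len: "3 \<le> length p" using p(1) by (cases "length p") auto
  have "{p ! i, p ! (Suc i mod length p)} \<in> insert {u, v} T" if i: "i < length p" for i
  proof (cases "Suc i = length p")
    case True
    then have "i = length p - 1" by simp
    then show ?thesis using True ends by (simp add: insert_commute)
  next
    case False
    then show ?thesis using edge[of i] i by simp
  qed
  then have "graph_cycle (insert {u, v} T) p" using len p(2) by (simp add: graph_cycle_def)
  then show ?thesis by blast
qed

lemma cycle_has_redundant_edge:
  assumes "graph_cycle T p"
  shows "\<exists>e\<in>T. \<forall>u v. conn T u v \<longrightarrow> conn (T - {e}) u v"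
proof -
  let ?n = "length p"
  have len: "3 \<le> ?n" and dist: "distinct p"
    and edge: "\<And>i. i < ?n \<Longrightarrow> {p ! i, p ! (Suc i mod ?n)} \<in> T"
    using assms by (auto simp: graph_cycle_def)
  have inj: "i = j" if "p ! i = p ! j" "i < ?n" "j < ?n" for i j
    using nth_eq_iff_index_eq[OF dist] that by blast
  let ?e = "{p ! (?n - 1), p ! 0}"
  have "Suc (?n - 1) = ?n" using len by simp
  then have e: "?e \<in> T" using edge[of "?n - 1"] len by simp
  have "conn (T - {?e}) (p ! 0) (p ! k)" if "k < ?n" for k
    using that
  proof (induction k)
    case (Suc k)
    have "{p ! k, p ! Suc k} \<in> T" using edge[of k] Suc.prems by simp
    moreover have "{p ! k, p ! Suc k} \<noteq> ?e"
    proof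
      assume "{p ! k, p ! Suc k} = ?e"
      then have "p ! k = p ! 0 \<and> p ! Suc k = p ! (?n - 1) \<or> p ! k = p ! (?n - 1) \<and> p ! Suc k = p ! 0"
        by (auto simp: doubleton_eq_iff)
      then show False
      proof
        assume "p ! k = p ! 0 \<and> p ! Suc k = p ! (?n - 1)"
        moreover have "k < ?n" "0 < ?n" "?n - 1 < ?n" using Suc.prems len by linarith+
        ultimately have "k = 0" "Suc k = ?n - 1"
          using inj[of k 0] inj[of "Suc k" "?n - 1"] Suc.prems by blast+
        then show False using len by linarith
      next
        assume "p ! k = p ! (?n - 1) \<and> p ! Suc k = p ! 0"
        moreover have "0 < ?n" using len by linarith
        ultimately have "Suc k = 0" using inj[of "Suc k" 0] Suc.prems by blast
        then show False by simp
      qed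
    qed
    ultimately have "conn (T - {?e}) (p ! k) (p ! Suc k)" by (intro conn_edge) simp
    then show ?case using Suc by (meson Suc_lessD rtrancl_trans)
  qed simp
  then have c: "conn (T - {?e}) (p ! 0) (p ! (?n - 1))" using len by simp
  have "conn (T - {?e}) u v" if "conn T u v" for u v
    using that
  proof (induction rule: rtrancl_induct)
    case (step y z)
    have "conn (T - {?e}) y z"
    proof (cases "{y, z} = ?e")
      case True
      then show ?thesis using c conn_sym[OF c] by (auto simp: doubleton_eq_iff)
    next
      case False
      then show ?thesis using step.hyps(2) by (intro conn_edge) simp
    qed
    then show ?case using step.IH by (metis rtrancl_trans)
  qed simp
  then show ?thesis using e by blast
qed

text \<open>Trades the absence of cycles for an edge count. A cycle would allow the removal of an
  edge, against the lower bound on the edges of a connected graph; conversely an acyclic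
  \<open>T\<close> coincides with the parent tree of any root.\<close>

lemma spanning_tree_iff_card:
  assumes E: "finite E" "\<And>e. e \<in> E \<Longrightarrow> e \<subseteq> V \<and> card e = 2" and V: "finite V"
  shows "spanning_tree V E T \<longleftrightarrow> T \<subseteq> E \<and> connected_graph V T \<and> card T + 1 = card V"
proof (cases "T \<subseteq> E \<and> connected_graph V T")
  case True
  then have T: "T \<subseteq> E" "finite T" "V \<noteq> {}" "\<And>u v. u \<in> V \<Longrightarrow> v \<in> V \<Longrightarrow> conn T u v"
    using E(1) finite_subset by (auto simp: connected_graph_def)
  obtain s where s: "s \<in> V" using T(3) by blast
  have lower: "card V \<le> 1 + card T'" if "\<And>u v. u \<in> V \<Longrightarrow> v \<in> V \<Longrightarrow> conn T' u v" "T' \<subseteq> T" for T'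
    using card_le_card_roots_plus_edges[of V "{s}" T'] that s finite_subset[OF that(2) T(2)] by auto
  have "(\<nexists>p. graph_cycle T p) \<longleftrightarrow> card T + 1 = card V"
  proof
    assume eq: "card T + 1 = card V"
    show "\<nexists>p. graph_cycle T p"
    proof
      assume "\<exists>p. graph_cycle T p"
      then obtain e where e: "e \<in> T" "\<And>u v. conn T u v \<Longrightarrow> conn (T - {e}) u v"
        using cycle_has_redundant_edge by metis
      have "card V \<le> 1 + card (T - {e})" using lower[of "T - {e}"] e(2) T(4) by auto
      moreover have "card (T - {e}) < card T" using e(1) T(2) by (rule card_Diff1_less[rotated])
      ultimately show False using eq by linarith
    qed
  next
    assume acyclic: "\<nexists>p. graph_cycle T p"
    obtain g where g: "inj_on g (V - {s})" "g ` (V - {s}) \<subseteq> T"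
      "(\<And>e. e \<in> T \<Longrightarrow> e \<subseteq> V) \<Longrightarrow> \<forall>v\<in>V. \<exists>r\<in>{s}. conn (g ` (V - {s})) r v"
      using parent_edges[of V "{s}" T] T(4) s by (metis singletonI)
    let ?T' = "g ` (V - {s})"
    have conn': "conn ?T' u v" if "u \<in> V" "v \<in> V" for u v
    proof -
      have "conn ?T' s u" "conn ?T' s v" using g(3) E(2) T(1) that by blast+
      then show ?thesis using conn_sym rtrancl_trans by metis
    qed
    \<comment> \<open>An edge of \<open>T\<close> outside the parent tree would close a cycle inside
      \<open>T\<close>.\<close>
    have "T \<subseteq> ?T'"
    proof
      fix e assume e: "e \<in> T"
      then obtain u v where uv: "e = {u, v}" "u \<noteq> v" "u \<in> V" "v \<in> V"
        using E(2) T(1) by (metis card_2_iff insert_subset subsetD)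
      show "e \<in> ?T'"
      proof (rule ccontr)
        assume "e \<notin> ?T'"
        then obtain p where "graph_cycle (insert e ?T') p"
          using non_edge_closes_cycle[OF conn'] uv by metis
        moreover have "insert e ?T' \<subseteq> T" using g(2) e by blast
        ultimately have "graph_cycle T p" unfolding graph_cycle_def by blast
        then show False using acyclic by blast
      qed
    qed
    then have "T = ?T'" using g(2) by blast
    then have "card T = card (V - {s})" using card_image[OF g(1)] by simp
    then show "card T + 1 = card V" using s V by (metis Suc_eq_plus1 card_Suc_Diff1)
  qed
  then show ?thesis using True by (auto simp: spanning_tree_def)
qed (auto simp: spanning_tree_def)

text \<open>Serves both for the corners of a graph and for the copies in the next graph: the copy
  \<open>i\<close> is the one that contains the outer corner \<open>i\<close>.\<close>

datatype side = Lft | Rgt | Top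

lemma UNIV_side: "UNIV = {Lft, Rgt, Top}"
  by (auto intro: side.exhaust)

instance side :: finite
  by standard (simp add: UNIV_side)

lemma all_side: "(\<forall>i. P i) \<longleftrightarrow> P Lft \<and> P Rgt \<and> P Top"
  using ball_UNIV[of P] by (simp add: UNIV_side)

section \<open>Forests with a prescribed pattern on the corners\<close>

text \<open>
  The partition of the three corners into components of a forest; \<open>Off i\<close> separates the corner \<open>i\<close>
  from the two others.
\<close>

datatype pattern = Joined | Off side | Apart

lemma pattern_cases:
  assumes "\<tau> = Joined \<Longrightarrow> P" "\<tau> = Off Lft \<Longrightarrow> P" "\<tau> = Off Rgt \<Longrightarrow> P" "\<tau> = Off Top \<Longrightarrow> P"
    "\<tau> = Apart \<Longrightarrow> P"
  shows P
proof (cases \<tau>)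
  case (Off i)
  then show ?thesis using assms by (cases i) simp_all
qed (use assms in simp_all)

lemma UNIV_pattern: "UNIV = {Joined, Off Lft, Off Rgt, Off Top, Apart}"
proof -
  have "\<tau> \<in> {Joined, Off Lft, Off Rgt, Off Top, Apart}" for \<tau>
    by (cases \<tau> rule: pattern_cases) simp_all
  then show ?thesis by blast
qed

instance pattern :: finite
  by standard (simp add: UNIV_pattern)

lemma ex_pattern:
  "(\<exists>\<tau>. P \<tau>) \<longleftrightarrow> P Joined \<or> P (Off Lft) \<or> P (Off Rgt) \<or> P (Off Top) \<or> P Apart"
  using bex_UNIV[of P] by (simp add: UNIV_pattern)

fun linked :: "pattern \<Rightarrow> side \<Rightarrow> side \<Rightarrow> bool" where
  "linked Joined i j \<longleftrightarrow> True"
| "linked (Off k) i j \<longleftrightarrow> i = j \<or> i \<noteq> k \<and> j \<noteq> k"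
| "linked Apart i j \<longleftrightarrow> i = j"

fun blocks :: "pattern \<Rightarrow> nat" where
  "blocks Joined = 1"
| "blocks (Off k) = 2"
| "blocks Apart = 3"

lemma linked_refl: "linked \<tau> i i"
  by (cases \<tau>) auto

lemma linked_sym: "linked \<tau> i j \<Longrightarrow> linked \<tau> j i"
  by (cases \<tau>) auto

lemma linked_trans: "linked \<tau> i j \<Longrightarrow> linked \<tau> j k \<Longrightarrow> linked \<tau> i k"
  by (cases \<tau>) auto

lemma linked_inject: "(\<And>i j. linked \<sigma> i j = linked \<tau> i j) \<Longrightarrow> \<sigma> = \<tau>"
proof -
  assume "\<And>i j. linked \<sigma> i j = linked \<tau> i j"
  then have "\<forall>i j. linked \<sigma> i j = linked \<tau> i j" by blast
  then show "\<sigma> = \<tau>"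
    by (cases \<sigma> rule: pattern_cases; cases \<tau> rule: pattern_cases) (simp_all add: all_side)
qed

text \<open>The five patterns are all the equivalence relations on three points.\<close>

lemma linked_exhaust:
  assumes "\<And>i. R i i" "\<And>i j. R i j \<Longrightarrow> R j i" "\<And>i j k. R i j \<Longrightarrow> R j k \<Longrightarrow> R i k"
  shows "\<exists>\<tau>. \<forall>i j. R i j = linked \<tau> i j"
proof -
  have "R Lft Lft" "R Rgt Rgt" "R Top Top" by (rule assms)+
  moreover have "R Rgt Lft = R Lft Rgt" "R Top Lft = R Lft Top" "R Top Rgt = R Rgt Top"
    using assms(2) by blast+
  moreover have "R Lft Rgt \<and> R Rgt Top \<longrightarrow> R Lft Top" "R Lft Rgt \<and> R Lft Top \<longrightarrow> R Rgt Top"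
    "R Lft Top \<and> R Rgt Top \<longrightarrow> R Lft Rgt"
    using assms(2,3) by blast+
  ultimately show ?thesis
    by (cases "R Lft Rgt"; cases "R Lft Top"; cases "R Rgt Top") (simp_all add: all_side ex_pattern)
qed

lemma linked_roots: "\<exists>S. card S = blocks \<tau> \<and> (\<forall>i. \<exists>s\<in>S. linked \<tau> i s)"
proof (cases \<tau> rule: pattern_cases)
  case 1
  then show ?thesis by (intro exI[of _ "{Lft}"]) simp
next
  case 2
  then show ?thesis by (intro exI[of _ "{Lft, Rgt}"]) (simp add: all_side)
next
  case 3
  then show ?thesis by (intro exI[of _ "{Lft, Rgt}"]) (simp add: all_side)
next
  case 4
  then show ?thesis by (intro exI[of _ "{Lft, Top}"]) (simp add: all_side)
next
  case 5
  then show ?thesis by (intro exI[of _ "{Lft, Rgt, Top}"]) (simp add: all_side)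
qed

text \<open>
  For a set of edges that connects every vertex to a corner, the equation on \<open>card T\<close> says that \<open>T\<close>
  has no cycle.
\<close>

definition covers :: "'a set \<Rightarrow> (side \<Rightarrow> 'a) \<Rightarrow> pattern \<Rightarrow> 'a set set \<Rightarrow> bool" where
  "covers V K \<tau> T \<longleftrightarrow>
     (\<forall>v\<in>V. \<exists>i. conn T (K i) v) \<and> (\<forall>i j. conn T (K i) (K j) \<longleftrightarrow> linked \<tau> i j)"

definition forests :: "'a set \<Rightarrow> 'a set set \<Rightarrow> (side \<Rightarrow> 'a) \<Rightarrow> pattern \<Rightarrow> 'a set set set" where
  "forests V E K \<tau> = {T. T \<subseteq> E \<and> covers V K \<tau> T \<and> card T + blocks \<tau> = card V}"

lemma forestsD: "T \<in> forests V E K \<tau> \<Longrightarrow> T \<subseteq> E"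
  by (simp add: forests_def)

lemma finite_forests: "finite E \<Longrightarrow> finite (forests V E K \<tau>)"
  by (rule finite_subset[of _ "Pow E"]) (auto simp: forests_def)

lemma covers_reach: "covers V K \<tau> T \<Longrightarrow> v \<in> V \<Longrightarrow> \<exists>i. conn T (K i) v"
  by (simp add: covers_def)

lemma covers_linked: "covers V K \<tau> T \<Longrightarrow> conn T (K i) (K j) \<longleftrightarrow> linked \<tau> i j"
  by (simp add: covers_def)

lemma covers_pattern_unique: "covers V K \<sigma> T \<Longrightarrow> covers V K \<tau> T \<Longrightarrow> \<sigma> = \<tau>"
  by (intro linked_inject) (simp add: covers_linked[symmetric])

text \<open>One corner from each block serves as a root, and every other vertex needs a parent edge
  of its own. \<open>forests\<close> consists of the sets for which this bound is sharp.\<close>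

lemma covers_card_le:
  assumes "covers V K \<tau> T" "finite T"
  shows "card V \<le> card T + blocks \<tau>"
proof -
  obtain S where S: "card S = blocks \<tau>" "\<And>i. \<exists>s\<in>S. linked \<tau> i s" using linked_roots by metis
  have "\<exists>s\<in>K ` S. conn T s v" if v: "v \<in> V" for v
  proof -
    obtain i where "conn T (K i) v" using covers_reach[OF assms(1) v] by blast
    moreover obtain s where "s \<in> S" "conn T (K s) (K i)"
      using S(2)[of i] covers_linked[OF assms(1)] linked_sym by metis
    ultimately have "conn T (K s) v" by (metis rtrancl_trans)
    then show ?thesis using \<open>s \<in> S\<close> by auto
  qed
  then have "card V \<le> card (K ` S) + card T"
    by (intro card_le_card_roots_plus_edges) (simp_all add: assms(2))
  moreover have "card (K ` S) \<le> card S" by (simp add: card_image_le)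
  ultimately show ?thesis using S(1) by linarith
qed

lemma spanning_tree_iff_Joined:
  assumes "finite E" "\<And>e. e \<in> E \<Longrightarrow> e \<subseteq> V \<and> card e = 2" "finite V" "\<And>i. K i \<in> V"
  shows "spanning_tree V E T \<longleftrightarrow> T \<in> forests V E K Joined"
proof -
  have "connected_graph V T \<longleftrightarrow> covers V K Joined T"
  proof
    show "covers V K Joined T" if "connected_graph V T"
      using that assms(4) unfolding covers_def connected_graph_def by auto
    assume c: "covers V K Joined T"
    have "conn T u v" if u: "u \<in> V" and v: "v \<in> V" for u v
    proof -
      obtain i j where "conn T (K i) u" "conn T (K j) v"
        using covers_reach[OF c u] covers_reach[OF c v] by blast
      moreover have "conn T (K i) (K j)" by (simp add: covers_linked[OF c])
      ultimately show ?thesis using conn_sym rtrancl_trans by metis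
    qed
    then show "connected_graph V T" using assms(4) unfolding connected_graph_def by blast
  qed
  moreover have "spanning_tree V E T \<longleftrightarrow> T \<subseteq> E \<and> connected_graph V T \<and> card T + 1 = card V"
    by (rule spanning_tree_iff_card) (use assms in auto)
  ultimately show ?thesis by (simp add: forests_def)
qed

section \<open>Gluing three copies\<close>

text \<open>
  The pair \<open>(i, j)\<close> stands for the corner \<open>j\<close> of the copy \<open>i\<close>; the pairs \<open>(i, j)\<close> and \<open>(j, i)\<close> are
  the same point, and \<open>(i, i)\<close> is an outer corner.
\<close>

inductive reach :: "(side \<Rightarrow> pattern) \<Rightarrow> side \<Rightarrow> side \<Rightarrow> side \<Rightarrow> bool" for \<sigma> a where
  start: "reach \<sigma> a a a"
| flip: "reach \<sigma> a i j \<Longrightarrow> reach \<sigma> a j i"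
| hop: "reach \<sigma> a i j \<Longrightarrow> linked (\<sigma> i) j k \<Longrightarrow> reach \<sigma> a i k"

text \<open>Closed forms for \<open>reach\<close>, with \<open>b\<close> and \<open>c\<close> the
  two copies other than \<open>a\<close>. From the outer corner of \<open>a\<close>, the joint with
  \<open>b\<close> is reached inside the copy \<open>a\<close> or by the detour through
  \<open>c\<close> and then \<open>b\<close>. The far joint is the one of \<open>b\<close> and
  \<open>c\<close>, and the outer corner of \<open>b\<close> is entered from either joint of
  \<open>b\<close>.\<close>

definition to_joint :: "(side \<Rightarrow> pattern) \<Rightarrow> side \<Rightarrow> side \<Rightarrow> side \<Rightarrow> bool" where
  "to_joint \<sigma> a b c \<longleftrightarrow> linked (\<sigma> a) a b \<or>
     linked (\<sigma> a) a c \<and> linked (\<sigma> c) a b \<and> linked (\<sigma> b) c a"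

definition to_far_joint :: "(side \<Rightarrow> pattern) \<Rightarrow> side \<Rightarrow> side \<Rightarrow> side \<Rightarrow> bool" where
  "to_far_joint \<sigma> a b c \<longleftrightarrow>
     to_joint \<sigma> a b c \<and> linked (\<sigma> b) a c \<or> to_joint \<sigma> a c b \<and> linked (\<sigma> c) a b"

definition to_corner :: "(side \<Rightarrow> pattern) \<Rightarrow> side \<Rightarrow> side \<Rightarrow> side \<Rightarrow> bool" where
  "to_corner \<sigma> a b c \<longleftrightarrow>
     to_joint \<sigma> a b c \<and> linked (\<sigma> b) a b \<or> to_far_joint \<sigma> a b c \<and> linked (\<sigma> b) c b"

lemma reach_to_joint: "to_joint \<sigma> a b c \<Longrightarrow> reach \<sigma> a a b"
  unfolding to_joint_def by (meson reach.intros)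

lemma reach_to_far_joint: "to_far_joint \<sigma> a b c \<Longrightarrow> reach \<sigma> a b c"
  unfolding to_far_joint_def by (meson reach_to_joint reach.flip reach.hop)

lemma reach_to_corner: "to_corner \<sigma> a b c \<Longrightarrow> reach \<sigma> a b b"
  unfolding to_corner_def by (meson reach_to_joint reach_to_far_joint reach.flip reach.hop)

lemma to_far_joint_commute: "to_far_joint \<sigma> a b c \<longleftrightarrow> to_far_joint \<sigma> a c b"
  unfolding to_far_joint_def by blast

lemma to_joint_hops:
  "linked (\<sigma> a) a b \<Longrightarrow> to_joint \<sigma> a b c"
  "to_joint \<sigma> a b c \<Longrightarrow> linked (\<sigma> a) b c \<Longrightarrow> to_joint \<sigma> a c b"
  "to_joint \<sigma> a b c \<Longrightarrow> linked (\<sigma> b) a c \<Longrightarrow> to_far_joint \<sigma> a b c"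
  "to_joint \<sigma> a b c \<Longrightarrow> linked (\<sigma> b) a b \<Longrightarrow> to_corner \<sigma> a b c"
  unfolding to_joint_def to_far_joint_def to_corner_def by (meson linked_sym linked_trans)+

lemma to_far_joint_hops:
  "to_far_joint \<sigma> a b c \<Longrightarrow> linked (\<sigma> b) c a \<Longrightarrow> to_joint \<sigma> a b c"
  "to_far_joint \<sigma> a b c \<Longrightarrow> linked (\<sigma> b) c b \<Longrightarrow> to_corner \<sigma> a b c"
  unfolding to_joint_def to_far_joint_def to_corner_def by (meson linked_sym linked_trans)+

lemma to_corner_hops:
  "to_corner \<sigma> a b c \<Longrightarrow> linked (\<sigma> b) b a \<Longrightarrow> to_joint \<sigma> a b c"
  "to_corner \<sigma> a b c \<Longrightarrow> linked (\<sigma> b) b c \<Longrightarrow> to_far_joint \<sigma> a b c"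
  unfolding to_joint_def to_far_joint_def to_corner_def by (meson linked_sym linked_trans)+

lemma reach_iff:
  assumes d: "a \<noteq> b" "a \<noteq> c" "b \<noteq> c"
  shows "reach \<sigma> a i j \<longleftrightarrow>
    (if i = j then if i = a then True else if i = b then to_corner \<sigma> a b c else to_corner \<sigma> a c b
     else if i \<noteq> a \<and> j \<noteq> a then to_far_joint \<sigma> a b c
     else if i = b \<or> j = b then to_joint \<sigma> a b c else to_joint \<sigma> a c b)"
    (is "_ = ?Q i j")
proof -
  have ex: "x = a \<or> x = b \<or> x = c" for x
    using d by (cases x; cases a; cases b; cases c) auto
  have "?Q i j" if "reach \<sigma> a i j"
    using that
  proof induction
    case start
    show ?case by simp
  next
    case (flip i j)
    then show ?case using ex[of i] ex[of j] d by (elim disjE) simp_all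
  next
    case (hop i j k)
    note d' = d d[THEN not_sym]
    have Q: "?Q i j" and l: "linked (\<sigma> i) j k" by fact+
    consider "j = k" | "j \<noteq> k" "i = a" | "j \<noteq> k" "i = b" | "j \<noteq> k" "i = c"
      using ex[of i] by blast
    then show ?case
    proof cases
      case 1
      with Q show ?thesis by (simp only:)
    next
      case 2
      then show ?thesis using Q l ex[of j] ex[of k]
        by (elim disjE; simp add: d'; blast intro: to_joint_hops)
    next
      case 3
      then show ?thesis using Q l ex[of j] ex[of k]
        by (elim disjE; simp add: d'; blast intro: to_joint_hops to_far_joint_hops to_corner_hops)
    next
      case 4
      then show ?thesis using Q l ex[of j] ex[of k]
        unfolding to_far_joint_commute[of \<sigma> a b c]
        by (elim disjE; simp add: d'; blast intro: to_joint_hops to_far_joint_hops to_corner_hops)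
    qed
  qed
  moreover have "reach \<sigma> a i j" if Q: "?Q i j"
  proof -
    have "to_far_joint \<sigma> a b c \<Longrightarrow> reach \<sigma> a c b"
      by (simp add: reach_to_far_joint to_far_joint_commute)
    moreover have "to_joint \<sigma> a b c \<Longrightarrow> reach \<sigma> a b a" "to_joint \<sigma> a c b \<Longrightarrow> reach \<sigma> a c a"
      by (rule reach.flip[OF reach_to_joint], assumption)+
    ultimately show ?thesis
      using Q ex[of i] ex[of j] d reach.start[of \<sigma> a] reach_to_joint[of \<sigma> a b c]
        reach_to_joint[of \<sigma> a c b] reach_to_far_joint[of \<sigma> a b c]
        reach_to_corner[of \<sigma> a b c] reach_to_corner[of \<sigma> a c b]
      by (elim disjE) simp_all
  qed
  ultimately show ?thesis by blast
qed

text \<open>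
  \<open>compatible \<sigma> \<tau>\<close>: gluing three forests with the patterns \<open>\<sigma>\<close> yields the pattern \<open>\<tau>\<close> and leaves no
  joint disconnected from the outer corners.
\<close>

definition compatible :: "(side \<Rightarrow> pattern) \<Rightarrow> pattern \<Rightarrow> bool" where
  "compatible \<sigma> \<tau> \<longleftrightarrow>
     (\<forall>i j. \<exists>a. reach \<sigma> a i j) \<and> (\<forall>i j. reach \<sigma> i j j \<longleftrightarrow> linked \<tau> i j)"

lemmas reach_from =
  reach_iff[of Lft Rgt Top, simplified] reach_iff[of Rgt Lft Top, simplified]
  reach_iff[of Top Lft Rgt, simplified]

text \<open>Makes \<open>compatible\<close> a finite Boolean formula in the values of
  \<open>linked\<close>, fit for exhaustive case analysis. Each joint has to be reached from one of
  the two adjacent outer corners or, as the far joint, from the third.\<close>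

lemma compatible_iff:
  "compatible \<sigma> \<tau> \<longleftrightarrow>
     (to_joint \<sigma> Lft Rgt Top \<or> to_joint \<sigma> Rgt Lft Top \<or> to_far_joint \<sigma> Top Lft Rgt) \<and>
     (to_joint \<sigma> Lft Top Rgt \<or> to_joint \<sigma> Top Lft Rgt \<or> to_far_joint \<sigma> Rgt Lft Top) \<and>
     (to_joint \<sigma> Rgt Top Lft \<or> to_joint \<sigma> Top Rgt Lft \<or> to_far_joint \<sigma> Lft Rgt Top) \<and>
     (to_corner \<sigma> Lft Rgt Top \<longleftrightarrow> linked \<tau> Lft Rgt) \<and>
     (to_corner \<sigma> Lft Top Rgt \<longleftrightarrow> linked \<tau> Lft Top) \<and>
     (to_corner \<sigma> Rgt Lft Top \<longleftrightarrow> linked \<tau> Rgt Lft) \<and>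
     (to_corner \<sigma> Rgt Top Lft \<longleftrightarrow> linked \<tau> Rgt Top) \<and>
     (to_corner \<sigma> Top Lft Rgt \<longleftrightarrow> linked \<tau> Top Lft) \<and>
     (to_corner \<sigma> Top Rgt Lft \<longleftrightarrow> linked \<tau> Top Rgt)"
proof -
  have ex: "(\<exists>i. P i) \<longleftrightarrow> P Lft \<or> P Rgt \<or> P Top" for P
    using bex_UNIV[of P] by (simp add: UNIV_side)
  show ?thesis
    unfolding compatible_def all_side ex reach_from
    by (simp add: linked_refl) (simp only: conj_ac disj_ac conj_left_absorb conj_absorb)
qed

text \<open>The triples of patterns whose gluing has the pattern \<open>\<tau>\<close> and closes no cycle.\<close>

fun glue_table :: "pattern \<Rightarrow> (pattern \<times> pattern \<times> pattern) set" where
  "glue_table Joined =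
      {(Joined, Joined, Off Lft), (Joined, Joined, Off Rgt), (Joined, Off Lft, Joined),
      (Joined, Off Top, Joined), (Off Rgt, Joined, Joined), (Off Top, Joined, Joined)}"
| "glue_table (Off Lft) =
      {(Joined, Off Lft, Off Lft), (Off Lft, Joined, Off Lft), (Off Lft, Joined, Off Rgt),
      (Off Lft, Off Lft, Joined), (Off Lft, Off Top, Joined), (Off Rgt, Joined, Off Lft),
      (Off Top, Off Lft, Joined), (Apart, Joined, Joined)}"
| "glue_table (Off Rgt) =
      {(Joined, Off Lft, Off Rgt), (Joined, Off Rgt, Off Lft), (Joined, Off Rgt, Off Rgt),
      (Joined, Apart, Joined), (Off Rgt, Joined, Off Rgt), (Off Rgt, Off Rgt, Joined),
      (Off Rgt, Off Top, Joined), (Off Top, Off Rgt, Joined)}"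
| "glue_table (Off Top) =
      {(Joined, Joined, Apart), (Joined, Off Lft, Off Top), (Joined, Off Top, Off Lft),
      (Joined, Off Top, Off Top), (Off Rgt, Joined, Off Top), (Off Top, Joined, Off Rgt),
      (Off Top, Joined, Off Top), (Off Top, Off Top, Joined)}"
| "glue_table Apart =
      {(Joined, Off Lft, Apart), (Joined, Off Rgt, Apart), (Joined, Apart, Off Lft),
      (Joined, Apart, Off Top), (Off Lft, Joined, Apart), (Off Lft, Off Lft, Off Rgt),
      (Off Lft, Off Lft, Off Top), (Off Lft, Off Rgt, Off Lft), (Off Lft, Off Rgt, Off Rgt),
      (Off Lft, Off Top, Off Lft), (Off Lft, Off Top, Off Top), (Off Lft, Apart, Joined),
      (Off Rgt, Joined, Apart), (Off Rgt, Off Rgt, Off Lft), (Off Rgt, Off Rgt, Off Top),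
      (Off Rgt, Off Top, Off Lft), (Off Rgt, Off Top, Off Top), (Off Top, Off Lft, Off Rgt),
      (Off Top, Off Lft, Off Top), (Off Top, Off Rgt, Off Rgt), (Off Top, Off Rgt, Off Top),
      (Off Top, Apart, Joined), (Apart, Joined, Off Rgt), (Apart, Joined, Off Top),
      (Apart, Off Rgt, Joined), (Apart, Off Top, Joined)}"

text \<open>Three identifications of points reduce the number of components by at most three, and in
  a compatible gluing every remaining component contains an outer corner.\<close>

lemma compatible_blocks_le:
  assumes "compatible \<sigma> \<tau>"
  shows "blocks (\<sigma> Lft) + blocks (\<sigma> Rgt) + blocks (\<sigma> Top) \<le> blocks \<tau> + 3"
  using assms
  unfolding compatible_iff to_corner_def to_far_joint_def to_joint_def
  by (cases "\<sigma> Lft" rule: pattern_cases; cases "\<sigma> Rgt" rule: pattern_cases;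
      cases "\<sigma> Top" rule: pattern_cases; simp; cases \<tau> rule: pattern_cases; simp)

text \<open>Equality means that each identification merges two different components, so that no
  cycle arises. The table itself is verified by running through all triples of patterns.\<close>

lemma compatible_tight_iff:
  "compatible \<sigma> \<tau> \<and> blocks (\<sigma> Lft) + blocks (\<sigma> Rgt) + blocks (\<sigma> Top) = blocks \<tau> + 3 \<longleftrightarrow>
     (\<sigma> Lft, \<sigma> Rgt, \<sigma> Top) \<in> glue_table \<tau>"
  unfolding compatible_iff to_corner_def to_far_joint_def to_joint_def
  by (cases "\<sigma> Lft" rule: pattern_cases; cases "\<sigma> Rgt" rule: pattern_cases;
      cases "\<sigma> Top" rule: pattern_cases; simp; cases \<tau> rule: pattern_cases; simp)

section \<open>Three graphs glued pairwise at corners\<close>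

locale gluing =
  fixes V :: "side \<Rightarrow> 'a set" and E :: "side \<Rightarrow> 'a set set" and K :: "side \<Rightarrow> side \<Rightarrow> 'a"
  assumes finite_V: "finite (V i)" and finite_E: "finite (E i)"
    and E_wf: "e \<in> E i \<Longrightarrow> e \<subseteq> V i \<and> card e = 2"
    and K_in: "K i j \<in> V i" and K_sym: "K i j = K j i"
    and V_Int: "i \<noteq> j \<Longrightarrow> V i \<inter> V j = {K i j}"
    and K_inj: "K i j = K i k \<Longrightarrow> j = k"
begin

lemma E_disjoint: "i \<noteq> j \<Longrightarrow> E i \<inter> E j = {}"
proof -
  assume "i \<noteq> j"
  have "False" if "e \<in> E i" "e \<in> E j" for e
  proof -
    have "e \<subseteq> {K i j}" "card e = 2" using that E_wf V_Int[OF \<open>i \<noteq> j\<close>] by blast+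
    then show False using card_mono[of "{K i j}" e] by simp
  qed
  then show ?thesis by blast
qed

lemma V_Int_corner: "v \<in> V i \<Longrightarrow> v \<in> V j \<Longrightarrow> i \<noteq> j \<Longrightarrow> v = K i j"
  using V_Int by blast

lemma card_V: "card (\<Union>i. V i) + 3 = card (V Lft) + card (V Rgt) + card (V Top)"
proof -
  have "(\<Union>i. V i) = V Lft \<union> V Rgt \<union> V Top" by (auto simp: UNIV_side)
  moreover have "V Lft \<inter> V Rgt \<inter> V Top = {}"
    using V_Int[of Lft Rgt] V_Int[of Lft Top] K_inj[of Lft Rgt Top] by auto
  ultimately show ?thesis
    using card_Un3[of "V Lft" "V Rgt" "V Top"] finite_V by (simp add: V_Int)
qed

text \<open>
  A walk leaves a copy only through a corner of that copy, so it can be cut into pieces that join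
  corners inside one copy.
\<close>

lemma conn_last_corner:
  assumes "conn (\<Union>i. T i) (K a b) v" and T: "\<And>i. T i \<subseteq> E i" and "P a b"
    and sym: "\<And>i j. P i j \<Longrightarrow> P j i"
    and step: "\<And>i j k. P i j \<Longrightarrow> conn (T i) (K i j) (K i k) \<Longrightarrow> P i k"
  shows "\<exists>i j. v \<in> V i \<and> P i j \<and> conn (T i) (K i j) v"
  using assms(1)
proof (induction rule: rtrancl_induct)
  case base
  show ?case using \<open>P a b\<close> K_in by blast
next
  case (step y z)
  then obtain i j where y: "y \<in> V i" "P i j" "conn (T i) (K i j) y" by blast
  obtain k where k: "{y, z} \<in> T k" using step.hyps(2) by auto
  then have yz: "y \<in> V k" "z \<in> V k" using T E_wf by blast+
  show ?case
  proof (cases "i = k")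
    case True
    then have "conn (T i) (K i j) z" using y(3) conn_edge[of y z "T k"] k by (metis rtrancl_trans)
    then show ?thesis using y(2) yz(2) True by blast
  next
    case False
    then have "y = K i k" using V_Int_corner y(1) yz(1) by blast
    then have "P k i" "y = K k i" using assms(5)[OF y(2), of k] y(3) sym K_sym by auto
    then show ?thesis using k yz(2) conn_edge[of y z "T k"] by blast
  qed
qed

text \<open>Connections between corners depend on the forests only through their patterns: a piece
  of a walk inside one copy is a \<open>hop\<close>, a change of copy at a joint is a
  \<open>flip\<close>.\<close>

lemma conn_corner_iff_reach:
  assumes T: "\<And>i. T i \<subseteq> E i" and link: "\<And>i j k. conn (T i) (K i j) (K i k) \<longleftrightarrow> linked (\<sigma> i) j k"
  shows "conn (\<Union>i. T i) (K a a) (K i j) \<longleftrightarrow> reach \<sigma> a i j"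
proof
  assume "conn (\<Union>i. T i) (K a a) (K i j)"
  then obtain k l where kl: "K i j \<in> V k" "reach \<sigma> a k l" "conn (T k) (K k l) (K i j)"
    using conn_last_corner[of a a "K i j" T "reach \<sigma> a"] T reach.intros link by metis
  show "reach \<sigma> a i j"
  proof (cases "k = i")
    case True
    then show ?thesis using kl link reach.hop by blast
  next
    case False
    \<comment> \<open>The walk may end in another copy than \<open>i\<close>. Then its end point is
      the joint of both copies, and \<open>flip\<close> renames it.\<close>
    then have eq: "K i j = K i k" using V_Int_corner[OF K_in kl(1)] by auto
    then have "K i j = K k i" "j = k" using K_sym K_inj by auto
    then have "reach \<sigma> a k i" using kl(2,3) link reach.hop by metis
    then show ?thesis using \<open>j = k\<close> reach.flip by blast
  qed
next
  assume "reach \<sigma> a i j"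
  then show "conn (\<Union>i. T i) (K a a) (K i j)"
  proof induction
    case (flip i j)
    then show ?case using K_sym by metis
  next
    case (hop i j k)
    then have "conn (T i) (K i j) (K i k)" using link by simp
    then have "conn (\<Union>i. T i) (K i j) (K i k)" by (rule conn_mono) blast
    then show ?case using hop.IH by (metis rtrancl_trans)
  qed simp
qed

text \<open>A walk from an outer corner to a vertex of a copy enters that copy through one of its
  corners, so the restriction to the copy still connects every vertex to a corner.\<close>

lemma covers_copy:
  assumes T: "\<And>i. T i \<subseteq> E i" and c: "covers (\<Union>i. V i) (\<lambda>i. K i i) \<tau> (\<Union>i. T i)"
  shows "\<exists>\<sigma>. covers (V i) (K i) \<sigma> (T i)"
proof -
  have "\<exists>j. conn (T i) (K i j) v" if v: "v \<in> V i" for v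
  proof -
    obtain a where "conn (\<Union>i. T i) (K a a) v" using covers_reach[OF c, of v] v by blast
    then obtain k l where kl: "v \<in> V k" "conn (T k) (K k l) v"
      using conn_last_corner[of a a v T "\<lambda>_ _. True"] T by blast
    show ?thesis
    proof (cases "k = i")
      case False
      then have "v = K i k" using V_Int_corner[OF v kl(1)] by auto
      then show ?thesis by blast
    qed (use kl in blast)
  qed
  moreover obtain \<sigma> where "\<forall>j k. conn (T i) (K i j) (K i k) = linked \<sigma> j k"
    using linked_exhaust[of "\<lambda>j k. conn (T i) (K i j) (K i k)"] conn_sym rtrancl_trans
    by (metis rtrancl.rtrancl_refl)
  ultimately show ?thesis unfolding covers_def by blast
qed

text \<open>Every vertex is connected inside its copy to a corner of that copy, so only the corners
  of the copies have to be tested.\<close>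

lemma covers_Union_iff:
  assumes T: "\<And>i. T i \<subseteq> E i" and c: "\<And>i. covers (V i) (K i) (\<sigma> i) (T i)"
  shows "covers (\<Union>i. V i) (\<lambda>i. K i i) \<tau> (\<Union>i. T i) \<longleftrightarrow> compatible \<sigma> \<tau>"
proof -
  let ?T = "\<Union>i. T i"
  have reach: "conn ?T (K a a) (K i j) \<longleftrightarrow> reach \<sigma> a i j" for a i j
    by (rule conn_corner_iff_reach[OF T covers_linked[OF c]])
  have "(\<forall>v\<in>\<Union>i. V i. \<exists>a. conn ?T (K a a) v) \<longleftrightarrow> (\<forall>i j. \<exists>a. conn ?T (K a a) (K i j))"
  proof
    assume l: "\<forall>v\<in>\<Union>i. V i. \<exists>a. conn ?T (K a a) v"
    show "\<forall>i j. \<exists>a. conn ?T (K a a) (K i j)"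
    proof (intro allI)
      fix i j
      have "K i j \<in> (\<Union>i. V i)" using K_in by blast
      then show "\<exists>a. conn ?T (K a a) (K i j)" by (rule bspec[OF l])
    qed
  next
    assume r: "\<forall>i j. \<exists>a. conn ?T (K a a) (K i j)"
    show "\<forall>v\<in>\<Union>i. V i. \<exists>a. conn ?T (K a a) v"
    proof
      fix v assume "v \<in> (\<Union>i. V i)"
      then obtain i where "v \<in> V i" by blast
      then obtain j where "conn (T i) (K i j) v" using covers_reach[OF c] by blast
      then have "conn ?T (K i j) v" by (rule conn_mono) blast
      moreover obtain a where "conn ?T (K a a) (K i j)" using r by blast
      ultimately have "conn ?T (K a a) v" by (metis rtrancl_trans)
      then show "\<exists>a. conn ?T (K a a) v" by blast
    qed
  qed
  then show ?thesis unfolding covers_def compatible_def reach by simp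
qed

lemma card_Union_copies:
  assumes "\<And>i. T i \<subseteq> E i"
  shows "card (\<Union>i. T i) = card (T Lft) + card (T Rgt) + card (T Top)"
proof -
  have "finite (T i)" for i using assms finite_E finite_subset by blast
  moreover have "T i \<inter> T j = {}" if "i \<noteq> j" for i j
    using E_disjoint[OF that] assms by blast
  ultimately have "card (T Lft \<union> T Rgt \<union> T Top) = card (T Lft) + card (T Rgt) + card (T Top)"
    using card_Un_disjoint[of "T Lft \<union> T Rgt" "T Top"] card_Un_disjoint[of "T Lft" "T Rgt"]
    by (simp add: Int_Un_distrib2)
  then show ?thesis by (simp add: UNIV_side Un_assoc)
qed

lemma Union_in_forests_iff:
  assumes T: "\<And>i. T i \<subseteq> E i"
  shows "(\<Union>i. T i) \<in> forests (\<Union>i. V i) (\<Union>i. E i) (\<lambda>i. K i i) \<tau> \<longleftrightarrow>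
    (\<exists>\<sigma>. (\<sigma> Lft, \<sigma> Rgt, \<sigma> Top) \<in> glue_table \<tau> \<and> (\<forall>i. T i \<in> forests (V i) (E i) (K i) (\<sigma> i)))"
    (is "?L \<longleftrightarrow> ?R")
proof
  assume L: ?L
  then have c: "covers (\<Union>i. V i) (\<lambda>i. K i i) \<tau> (\<Union>i. T i)"
    and card: "card (\<Union>i. T i) + blocks \<tau> = card (\<Union>i. V i)" by (auto simp: forests_def)
  obtain \<sigma> where \<sigma>: "\<And>i. covers (V i) (K i) (\<sigma> i) (T i)" using covers_copy[OF T c] by metis
  have comp: "compatible \<sigma> \<tau>" using covers_Union_iff[OF T \<sigma>] c by simp
  have le: "card (V i) \<le> card (T i) + blocks (\<sigma> i)" for i
    using covers_card_le[OF \<sigma>] T finite_E finite_subset by blast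
  \<comment> \<open>The sum of the \<open>card (V i)\<close> is at most that of
    \<open>card (T i) + blocks (\<sigma> i)\<close>, hence at most
    \<open>card (\<Union>i. T i) + blocks \<tau> + 3\<close>, which equals the sum one started from.
    So every inequality used is an equality.\<close>
  note card_eqs = card[unfolded card_Union_copies[OF T]] card_V compatible_blocks_le[OF comp]
    le[of Lft] le[of Rgt] le[of Top]
  have "blocks (\<sigma> Lft) + blocks (\<sigma> Rgt) + blocks (\<sigma> Top) = blocks \<tau> + 3"
    using card_eqs by linarith
  then have "(\<sigma> Lft, \<sigma> Rgt, \<sigma> Top) \<in> glue_table \<tau>" using comp compatible_tight_iff by blast
  moreover have "\<forall>i. card (T i) + blocks (\<sigma> i) = card (V i)"
    unfolding all_side using card_eqs by linarith
  ultimately show ?R using \<sigma> T unfolding forests_def by blast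
next
  assume ?R
  then obtain \<sigma> where table: "(\<sigma> Lft, \<sigma> Rgt, \<sigma> Top) \<in> glue_table \<tau>"
    and f: "\<And>i. T i \<in> forests (V i) (E i) (K i) (\<sigma> i)" by blast
  have \<sigma>: "covers (V i) (K i) (\<sigma> i) (T i)" and card: "card (T i) + blocks (\<sigma> i) = card (V i)" for i
    using f by (auto simp: forests_def)
  have comp: "compatible \<sigma> \<tau>"
    and bl: "blocks (\<sigma> Lft) + blocks (\<sigma> Rgt) + blocks (\<sigma> Top) = blocks \<tau> + 3"
    using table compatible_tight_iff by blast+
  have "card (\<Union>i. T i) + blocks \<tau> = card (\<Union>i. V i)"
    using bl card[of Lft] card[of Rgt] card[of Top] card_V unfolding card_Union_copies[OF T]
    by linarith
  moreover have "(\<Union>i. T i) \<subseteq> (\<Union>i. E i)" using T by blast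
  ultimately show ?L using covers_Union_iff[OF T \<sigma>] comp by (simp add: forests_def)
qed

end

section \<open>Degree counts of glued forests\<close>

definition deg_count :: "'a set \<Rightarrow> 'a set set \<Rightarrow> (side \<Rightarrow> 'a) \<Rightarrow> pattern \<Rightarrow> 'a \<Rightarrow> nat \<Rightarrow> real" where
  "deg_count V E K \<tau> x d = real (card {T \<in> forests V E K \<tau>. degree_in T x = d})"

lemma deg_count_eq_sum:
  assumes "finite E"
  shows "deg_count V E K \<tau> x d = (\<Sum>T\<in>forests V E K \<tau>. of_bool (degree_in T x = d))"
proof -
  have "{T \<in> forests V E K \<tau>. degree_in T x = d} = forests V E K \<tau> \<inter> {T. degree_in T x = d}" by blast
  then show ?thesis unfolding deg_count_def using finite_forests[OF assms] by simp
qed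

definition mix :: "pattern \<Rightarrow> (side \<Rightarrow> pattern \<Rightarrow> real) \<Rightarrow> real" where
  "mix \<tau> F = (\<Sum>(p, q, r)\<in>glue_table \<tau>. F Lft p * F Rgt q * F Top r)"

lemma prod_side: "(\<Prod>i\<in>UNIV. f i) = f Lft * f Rgt * (f Top :: 'b :: comm_monoid_mult)"
  by (simp add: UNIV_side mult.assoc)

lemma sum_side: "(\<Sum>i\<in>UNIV. f i) = f Lft + f Rgt + (f Top :: 'b :: comm_monoid_add)"
  by (simp add: UNIV_side add.assoc)

lemma prod_if_eq:
  "(\<Prod>k\<in>UNIV. if k = i then f k else (1 :: real)) = f (i :: side)"
  by (subst prod.delta) simp_all

context gluing
begin

abbreviation glued_forests :: "pattern \<Rightarrow> 'a set set set" where
  "glued_forests \<tau> \<equiv> forests (\<Union>i. V i) (\<Union>i. E i) (\<lambda>i. K i i) \<tau>"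

abbreviation copy_forests :: "side \<Rightarrow> pattern \<Rightarrow> 'a set set set" where
  "copy_forests i \<tau> \<equiv> forests (V i) (E i) (K i) \<tau>"

lemma Union_Int_copies:
  assumes "T \<subseteq> (\<Union>i. E i)"
  shows "(\<Union>i. T \<inter> E i) = T"
  using assms by blast

lemma Int_copy_Union:
  assumes "\<And>i. T i \<subseteq> E i"
  shows "(\<Union>i. T i) \<inter> E k = T k"
proof -
  have "T i \<inter> E k = {}" if "i \<noteq> k" for i
    using E_disjoint[OF that] assms by blast
  then show ?thesis using assms by fast
qed

text \<open>Cutting is a bijection onto the triples of forests whose patterns lie in the table, so a
  weight that factors over the copies sums to the trilinear form \<open>mix\<close>. Constant
  weights give the numbers of forests, indicators of degrees give the degree counts.\<close>

theorem sum_prod_glued_forests: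
  fixes w :: "side \<Rightarrow> 'a set set \<Rightarrow> real"
  shows "(\<Sum>T\<in>glued_forests \<tau>. \<Prod>i\<in>UNIV. w i (T \<inter> E i)) =
    mix \<tau> (\<lambda>i \<sigma>. \<Sum>T\<in>copy_forests i \<sigma>. w i T)"
proof -
  define G where "G = {\<sigma>. (\<sigma> Lft, \<sigma> Rgt, \<sigma> Top) \<in> glue_table \<tau>}"
  define S where "S = (\<lambda>\<sigma>. PiE UNIV (\<lambda>i :: side. copy_forests i (\<sigma> i)))"
  have S_iff: "T \<in> S \<sigma> \<longleftrightarrow> (\<forall>i. T i \<in> copy_forests i (\<sigma> i))" for T \<sigma>
    by (auto simp: S_def PiE_def)
  have S_sub: "T i \<subseteq> E i" if "T \<in> (\<Union>\<sigma>\<in>G. S \<sigma>)" for T i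
    using that S_iff forestsD by blast
  have glue: "(\<Union>i. T i) \<in> glued_forests \<tau> \<longleftrightarrow> T \<in> (\<Union>\<sigma>\<in>G. S \<sigma>)" if "\<And>i. T i \<subseteq> E i" for T
    unfolding Union_in_forests_iff[of T, OF that] by (auto simp: S_iff G_def)
  have "(\<Sum>T\<in>glued_forests \<tau>. \<Prod>i\<in>UNIV. w i (T \<inter> E i)) =
      (\<Sum>T\<in>(\<Union>\<sigma>\<in>G. S \<sigma>). \<Prod>i\<in>UNIV. w i (T i))"
  proof (rule sum.reindex_bij_witness[where i = "\<lambda>T. \<Union>i. T i" and j = "\<lambda>T i. T \<inter> E i"])
    fix T assume T: "T \<in> glued_forests \<tau>"
    show eq: "(\<Union>i. T \<inter> E i) = T" by (rule Union_Int_copies[OF forestsD[OF T]])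
    show "(\<lambda>i. T \<inter> E i) \<in> (\<Union>\<sigma>\<in>G. S \<sigma>)"
      using glue[of "\<lambda>i. T \<inter> E i", OF Int_lower2] T unfolding eq by simp
  next
    fix T assume T: "T \<in> (\<Union>\<sigma>\<in>G. S \<sigma>)"
    then have sub: "\<And>i. T i \<subseteq> E i" by (rule S_sub)
    show "(\<lambda>i. (\<Union>i. T i) \<inter> E i) = T" by (rule ext) (rule Int_copy_Union[of T, OF sub])
    show "(\<Union>i. T i) \<in> glued_forests \<tau>" using glue[of T, OF sub] T by simp
  qed simp
  also have "\<dots> = (\<Sum>\<sigma>\<in>G. \<Sum>T\<in>S \<sigma>. \<Prod>i\<in>UNIV. w i (T i))"
  proof (rule sum.UNION_disjoint)
    show "\<forall>\<sigma>\<in>G. finite (S \<sigma>)" by (simp add: S_def finite_PiE finite_forests finite_E)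
    \<comment> \<open>A forest determines its pattern, so different triples of patterns share no
      triple of forests.\<close>
    show "\<forall>\<sigma>\<in>G. \<forall>\<rho>\<in>G. \<sigma> \<noteq> \<rho> \<longrightarrow> S \<sigma> \<inter> S \<rho> = {}"
    proof (intro ballI impI)
      fix \<sigma> \<rho> :: "side \<Rightarrow> pattern" assume "\<sigma> \<noteq> \<rho>"
      then obtain i where i: "\<sigma> i \<noteq> \<rho> i" by blast
      have "False" if "T \<in> S \<sigma>" "T \<in> S \<rho>" for T
      proof -
        have "covers (V i) (K i) (\<sigma> i) (T i)" "covers (V i) (K i) (\<rho> i) (T i)"
          using that by (simp_all add: S_iff forests_def)
        then show False using covers_pattern_unique i by blast
      qed
      then show "S \<sigma> \<inter> S \<rho> = {}" by blast
    qed
  qed simp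
  also have "\<dots> = (\<Sum>\<sigma>\<in>G. \<Prod>i\<in>UNIV. \<Sum>T\<in>copy_forests i (\<sigma> i). w i T)"
    unfolding S_def by (subst prod_sum_PiE) (simp_all add: finite_forests finite_E)
  also have "\<dots> = mix \<tau> (\<lambda>i \<sigma>. \<Sum>T\<in>copy_forests i \<sigma>. w i T)"
    unfolding mix_def
    by (rule sum.reindex_bij_witness[where j = "\<lambda>\<sigma>. (\<sigma> Lft, \<sigma> Rgt, \<sigma> Top)"
          and i = "\<lambda>(p, q, r) i. case i of Lft \<Rightarrow> p | Rgt \<Rightarrow> q | Top \<Rightarrow> r"])
      (auto simp: G_def prod_side fun_eq_iff split: side.split)
  finally show ?thesis .
qed

lemma degree_in_eq_sum_copies:
  assumes "T \<subseteq> (\<Union>i. E i)"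
  shows "degree_in T x = (\<Sum>i\<in>UNIV. degree_in (T \<inter> E i) x)"
proof -
  have "{e \<in> T. x \<in> e} = (\<Union>i. {e \<in> T \<inter> E i. x \<in> e})" using assms by blast
  moreover have "card (\<Union>i. {e \<in> T \<inter> E i. x \<in> e}) = (\<Sum>i\<in>UNIV. card {e \<in> T \<inter> E i. x \<in> e})"
    by (rule card_UN_disjoint) (use finite_E E_disjoint in auto)
  ultimately show ?thesis unfolding degree_in_def by simp
qed

lemma degree_in_outside:
  assumes "x \<notin> V i"
  shows "degree_in (T \<inter> E i) x = 0"
proof -
  have "{e \<in> T \<inter> E i. x \<in> e} = {}" using E_wf assms by blast
  then show ?thesis by (simp only: degree_in_def card.empty)
qed

lemma finite_UN_E: "finite (\<Union>i. E i)"
  using finite_E by simp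

lemma card_glued_forests:
  "real (card (glued_forests \<tau>)) = mix \<tau> (\<lambda>i \<sigma>. real (card (copy_forests i \<sigma>)))"
  using sum_prod_glued_forests[of "\<lambda>_ _. 1" \<tau>] by simp

lemma deg_count_private:
  assumes "\<And>k. k \<noteq> i \<Longrightarrow> x \<notin> V k"
  shows "deg_count (\<Union>i. V i) (\<Union>i. E i) (\<lambda>i. K i i) \<tau> x d =
    mix \<tau> (\<lambda>k \<sigma>. if k = i then deg_count (V i) (E i) (K i) \<sigma> x d
                    else real (card (copy_forests k \<sigma>)))"
proof -
  have "degree_in T x = degree_in (T \<inter> E i) x" if "T \<in> glued_forests \<tau>" for T
  proof -
    have "degree_in T x = (\<Sum>k\<in>UNIV. if k = i then degree_in (T \<inter> E i) x else 0)"
      unfolding degree_in_eq_sum_copies[OF forestsD[OF that]]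
      by (rule sum.cong) (use assms degree_in_outside in auto)
    then show ?thesis by simp
  qed
  then have "deg_count (\<Union>i. V i) (\<Union>i. E i) (\<lambda>i. K i i) \<tau> x d =
      (\<Sum>T\<in>glued_forests \<tau>.
         \<Prod>k\<in>UNIV. if k = i then of_bool (degree_in (T \<inter> E k) x = d) else 1)"
    unfolding deg_count_eq_sum[OF finite_UN_E] prod_if_eq by (intro sum.cong) simp_all
  also have "\<dots> = mix \<tau> (\<lambda>k \<sigma>. \<Sum>T\<in>copy_forests k \<sigma>.
      if k = i then of_bool (degree_in T x = d) else 1)"
    by (rule sum_prod_glued_forests)
  also have "\<dots> = mix \<tau> (\<lambda>k \<sigma>. if k = i then deg_count (V i) (E i) (K i) \<sigma> x d
      else real (card (copy_forests k \<sigma>)))"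
    by (intro arg_cong2[where f = mix] refl ext) (simp add: deg_count_eq_sum finite_E)
  finally show ?thesis .
qed

text \<open>The degree of a joint is the sum of its degrees in the two copies, whence a
  convolution.\<close>

lemma deg_count_joint:
  assumes "i \<noteq> j"
  shows "deg_count (\<Union>i. V i) (\<Union>i. E i) (\<lambda>i. K i i) \<tau> (K i j) m =
    (\<Sum>d\<le>m. mix \<tau> (\<lambda>k \<sigma>. if k = i then deg_count (V i) (E i) (K i) \<sigma> (K i j) d
                    else if k = j then deg_count (V j) (E j) (K j) \<sigma> (K j i) (m - d)
                    else real (card (copy_forests k \<sigma>))))"
proof -
  let ?x = "K i j"
  have out: "?x \<notin> V k" if "k \<noteq> i" "k \<noteq> j" for k
    using V_Int_corner[of ?x i k] K_in[of i j] K_inj[of i j k] that by metis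
  have deg: "degree_in T ?x = degree_in (T \<inter> E i) ?x + degree_in (T \<inter> E j) ?x"
    if "T \<in> glued_forests \<tau>" for T
  proof -
    have "degree_in T ?x = (\<Sum>k\<in>UNIV. (if k = i then degree_in (T \<inter> E i) ?x else 0) +
        (if k = j then degree_in (T \<inter> E j) ?x else 0))"
      unfolding degree_in_eq_sum_copies[OF forestsD[OF that]]
      by (rule sum.cong) (use assms out degree_in_outside in auto)
    then show ?thesis unfolding sum.distrib by simp
  qed
  let ?w = "\<lambda>d k T. if k = i then of_bool (degree_in T ?x = d)
    else if k = j then of_bool (degree_in T ?x = m - d) else (1 :: real)"
  have prod: "(\<Prod>k\<in>UNIV. ?w d k (T \<inter> E k)) =
      of_bool (degree_in (T \<inter> E i) ?x = d) * of_bool (degree_in (T \<inter> E j) ?x = m - d)" for d T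
    using assms by (cases i; cases j; simp add: prod_side)
  \<comment> \<open>Only the term \<open>d = a\<close> can survive; the range
    \<open>d \<le> m\<close> keeps the subtraction \<open>m - d\<close> from being
    truncated.\<close>
  have conv: "of_bool (a + b = m) = (\<Sum>d\<le>m. of_bool (a = d) * of_bool (b = m - d) :: real)" for a b
  proof -
    have "(\<Sum>d\<le>m. of_bool (a = d) * of_bool (b = m - d) :: real) =
        (\<Sum>d\<le>m. if a = d then of_bool (b = m - a) else 0)"
      by (intro sum.cong) auto
    also have "\<dots> = of_bool (a + b = m)" by (subst sum.delta') auto
    finally show ?thesis by simp
  qed
  have "deg_count (\<Union>i. V i) (\<Union>i. E i) (\<lambda>i. K i i) \<tau> ?x m =
      (\<Sum>T\<in>glued_forests \<tau>. \<Sum>d\<le>m. \<Prod>k\<in>UNIV. ?w d k (T \<inter> E k))"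
    unfolding deg_count_eq_sum[OF finite_UN_E] prod by (intro sum.cong refl) (simp only: deg conv)
  also have "\<dots> = (\<Sum>d\<le>m. \<Sum>T\<in>glued_forests \<tau>. \<Prod>k\<in>UNIV. ?w d k (T \<inter> E k))"
    by (rule sum.swap)
  also have "\<dots> = (\<Sum>d\<le>m. mix \<tau> (\<lambda>k \<sigma>. \<Sum>T\<in>copy_forests k \<sigma>. ?w d k T))"
    by (rule sum.cong[OF refl]) (rule sum_prod_glued_forests[of "?w d" \<tau> for d])
  also have "\<dots> = (\<Sum>d\<le>m. mix \<tau> (\<lambda>k \<sigma>. if k = i then deg_count (V i) (E i) (K i) \<sigma> ?x d
                    else if k = j then deg_count (V j) (E j) (K j) \<sigma> (K j i) (m - d)
                    else real (card (copy_forests k \<sigma>))))"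
    by (intro sum.cong arg_cong2[where f = mix] refl ext)
      (simp add: deg_count_eq_sum finite_E K_sym[of j i])
  finally show ?thesis .
qed

end

section \<open>Invariance under injective maps of the vertices\<close>

lemma inj_image: "inj f \<Longrightarrow> inj ((`) f)"
  by (rule injI) (simp add: inj_image_eq_iff)

lemma conn_image_iff:
  assumes "inj f"
  shows "conn ((`) f ` T) (f u) (f v) \<longleftrightarrow> conn T u v"
proof
  have "\<exists>v. b = f v \<and> conn T u v" if "conn ((`) f ` T) (f u) b" for b
    using that
  proof (induction rule: rtrancl_induct)
    case (step y z)
    then obtain v where v: "y = f v" "conn T u v" by blast
    obtain e where e: "e \<in> T" "{f v, z} = f ` e" using step.hyps(2) v(1) by auto
    then obtain w where "z = f w" by (metis imageE insertCI)
    then have "f ` e = f ` {v, w}" using e(2) by simp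
    then have "e = {v, w}" using assms by (simp only: inj_image_eq_iff)
    then have "conn T u w" using e(1) v(2) conn_edge[of v w T] by (metis rtrancl_trans)
    then show ?case using \<open>z = f w\<close> by blast
  qed blast
  then show "conn T u v" if "conn ((`) f ` T) (f u) (f v)"
    using that assms by (metis injD)
next
  assume "conn T u v"
  then show "conn ((`) f ` T) (f u) (f v)"
  proof (induction rule: rtrancl_induct)
    case (step y z)
    then have "f ` {y, z} \<in> (`) f ` T" by (intro imageI) simp
    then have "conn ((`) f ` T) (f y) (f z)" by (intro conn_edge) simp
    then show ?case using step.IH by (metis rtrancl_trans)
  qed simp
qed

lemma forests_image:
  assumes "inj f"
  shows "forests (f ` V) ((`) f ` E) (\<lambda>i. f (K i)) \<tau> = (`) ((`) f) ` forests V E K \<tau>"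
proof -
  note inj = inj_image[OF assms]
  have "(`) f ` T \<in> forests (f ` V) ((`) f ` E) (\<lambda>i. f (K i)) \<tau> \<longleftrightarrow> T \<in> forests V E K \<tau>" for T
    unfolding forests_def covers_def
    by (simp add: conn_image_iff[OF assms] inj_image_subset_iff[OF inj]
        card_image[OF inj_on_subset[OF inj subset_UNIV]]
        card_image[OF inj_on_subset[OF assms subset_UNIV]])
  moreover have "\<exists>T'. T = (`) f ` T'" if "T \<in> forests (f ` V) ((`) f ` E) (\<lambda>i. f (K i)) \<tau>" for T
    using forestsD[OF that] by (metis subset_imageE)
  ultimately show ?thesis by blast
qed

lemma degree_in_image:
  assumes "inj f"
  shows "degree_in ((`) f ` T) (f x) = degree_in T x"
proof -
  have "{e \<in> (`) f ` T. f x \<in> e} = (`) f ` {e \<in> T. x \<in> e}"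
    using inj_image_mem_iff[OF assms] by blast
  moreover have "inj_on ((`) f) A" for A using inj_image[OF assms] inj_on_subset by blast
  ultimately show ?thesis unfolding degree_in_def by (simp add: card_image)
qed

lemma card_forests_image:
  assumes "inj f"
  shows "card (forests (f ` V) ((`) f ` E) (\<lambda>i. f (K i)) \<tau>) = card (forests V E K \<tau>)"
  unfolding forests_image[OF assms]
  by (rule card_image) (rule inj_on_subset[OF inj_image[OF inj_image[OF assms]] subset_UNIV])

lemma deg_count_image:
  assumes "inj f"
  shows "deg_count (f ` V) ((`) f ` E) (\<lambda>i. f (K i)) \<tau> (f x) d = deg_count V E K \<tau> x d"
proof -
  have "{T \<in> (`) ((`) f) ` forests V E K \<tau>. degree_in T (f x) = d} =
      (`) ((`) f) ` {T \<in> forests V E K \<tau>. degree_in T x = d}"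
  proof -
    have "{T \<in> g ` A. P T} = g ` {T \<in> A. P (g T)}" for g :: "'a set set \<Rightarrow> 'b set set" and A P
      by blast
    then show ?thesis by (simp only: degree_in_image[OF assms])
  qed
  moreover have "inj_on ((`) ((`) f)) A" for A
    by (rule inj_on_subset[OF inj_image[OF inj_image[OF assms]] subset_UNIV])
  ultimately show ?thesis unfolding deg_count_def forests_image[OF assms] by (simp add: card_image)
qed

lemma mix_sum_slot:
  "mix \<tau> (\<lambda>k \<sigma>. if k = i then \<Sum>x\<in>A. f x \<sigma> else g k \<sigma>) =
    (\<Sum>x\<in>A. mix \<tau> (\<lambda>k \<sigma>. if k = i then f x \<sigma> else g k \<sigma>))"
  unfolding mix_def
  by (subst sum.swap, cases i; intro sum.cong refl; clarsimp simp: sum_distrib_left sum_distrib_right)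

context gluing
begin

lemma corner_eqD: "K i i = K j k \<Longrightarrow> i = j \<and> i = k"
  using V_Int_corner[of "K i i" i j] K_in K_inj by metis

lemma interior_private: "x \<in> V i - range (K i) \<Longrightarrow> k \<noteq> i \<Longrightarrow> x \<notin> V k"
  using V_Int_corner[of x i k] by blast

lemma sum_interior:
  fixes g :: "'a \<Rightarrow> real"
  shows "(\<Sum>x\<in>(\<Union>i. V i) - range (\<lambda>i. K i i). g x) =
    (\<Sum>i\<in>UNIV. \<Sum>x\<in>V i - range (K i). g x) + (g (K Lft Rgt) + g (K Lft Top) + g (K Rgt Top))"
proof -
  let ?I = "\<Union>i. V i - range (K i)" and ?J = "{K Lft Rgt, K Lft Top, K Rgt Top}"
  have J: "K i j \<in> ?J" if "i \<noteq> j" for i j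
    using that K_sym by (cases i; cases j; simp)
  have joint: "\<exists>i j. i \<noteq> j \<and> x = K i j" if "x \<in> ?J" for x
    using that side.distinct by blast
  have "(\<Union>i. V i) - range (\<lambda>i. K i i) = ?I \<union> ?J"
  proof (intro equalityI subsetI)
    fix x assume x: "x \<in> (\<Union>i. V i) - range (\<lambda>i. K i i)"
    then obtain i where i: "x \<in> V i" by blast
    show "x \<in> ?I \<union> ?J"
    proof (cases "x \<in> range (K i)")
      case True
      then obtain j where "x = K i j" by blast
      moreover then have "i \<noteq> j" using x by blast
      ultimately show ?thesis using J by blast
    qed (use i in blast)
  next
    fix x assume "x \<in> ?I \<union> ?J"
    then show "x \<in> (\<Union>i. V i) - range (\<lambda>i. K i i)"
    proof
      assume "x \<in> ?I"
      then obtain i where i: "x \<in> V i - range (K i)" by blast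
      then have "x \<noteq> K j j" for j using interior_private[OF i, of j] K_in[of j j] by blast
      then show ?thesis using i by blast
    next
      assume "x \<in> ?J"
      then obtain i j where ij: "i \<noteq> j" "x = K i j" using joint by blast
      then have "x \<noteq> K k k" for k using corner_eqD[of k i j] by metis
      then show ?thesis using ij(2) K_in[of i j] by blast
    qed
  qed
  moreover have "?I \<inter> ?J = {}"
  proof -
    have "False" if "x \<in> V k - range (K k)" "x = K i j" for x i j k
      using that interior_private[OF that(1), of i] K_in[of i j] by blast
    then show ?thesis by blast
  qed
  moreover have fin: "finite ?I" "finite ?J" using finite_V by simp_all
  ultimately have "(\<Sum>x\<in>(\<Union>i. V i) - range (\<lambda>i. K i i). g x) = (\<Sum>x\<in>?I. g x) + (\<Sum>x\<in>?J. g x)"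
    by (simp only: sum.union_disjoint[OF fin])
  moreover have "(\<Sum>x\<in>?I. g x) = (\<Sum>i\<in>UNIV. \<Sum>x\<in>V i - range (K i). g x)"
  proof (rule sum.UNION_disjoint)
    show "\<forall>i\<in>UNIV. \<forall>j\<in>UNIV. i \<noteq> j \<longrightarrow> (V i - range (K i)) \<inter> (V j - range (K j)) = {}"
      using interior_private by blast
  qed (use finite_V in auto)
  moreover have "(\<Sum>x\<in>?J. g x) = g (K Lft Rgt) + g (K Lft Top) + g (K Rgt Top)"
  proof -
    have "K Lft Rgt \<noteq> K Lft Top" "K Lft Top \<noteq> K Rgt Top" using K_inj K_sym side.distinct by metis+
    moreover have "K Lft Rgt \<noteq> K Rgt Top" using K_inj[of Rgt Lft Top] K_sym[of Lft Rgt] by auto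
    ultimately show ?thesis by simp
  qed
  ultimately show ?thesis by simp
qed

end

section \<open>Recursions for the gasket\<close>

fun corner :: "nat \<Rightarrow> side \<Rightarrow> nat \<times> nat" where
  "corner n Lft = (0, 0)"
| "corner n Rgt = (2 ^ n, 0)"
| "corner n Top = (0, 2 ^ n)"

text \<open>The displacement of the copy \<open>i\<close> is its corner vector
  \<open>corner n i\<close>. Corner \<open>j\<close> of copy \<open>i\<close> is thus
  \<open>corner n i + corner n j\<close>, and the identification of the pairs \<open>(i, j)\<close>
  and \<open>(j, i)\<close> is commutativity of addition.\<close>

abbreviation copy :: "nat \<Rightarrow> side \<Rightarrow> nat \<times> nat \<Rightarrow> nat \<times> nat" where
  "copy n i \<equiv> (+) (corner n i)"

lemma corner_in: "corner n i \<in> sg_verts n"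
  by (cases i) (simp_all add: sg_corners)

lemma sg_verts_Suc: "sg_verts (Suc n) = (\<Union>i. copy n i ` sg_verts n)"
  by (simp add: UNIV_side zero_prod_def[symmetric] Un_assoc)

lemma sg_edges_Suc: "sg_edges (Suc n) = (\<Union>i. (`) (copy n i) ` sg_edges n)"
  by (simp add: UNIV_side zero_prod_def[symmetric] Un_assoc)

lemma corner_Suc: "corner (Suc n) = (\<lambda>i. copy n i (corner n i))"
proof
  show "corner (Suc n) i = copy n i (corner n i)" for i by (cases i) simp_all
qed

lemma gluing_sg:
  "gluing (\<lambda>i. copy n i ` sg_verts n) (\<lambda>i. (`) (copy n i) ` sg_edges n) (\<lambda>i j. copy n i (corner n j))"
proof
  fix i j k
  show "finite (copy n i ` sg_verts n)" "finite ((`) (copy n i) ` sg_edges n)"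
    using finite_sg_verts finite_sg_edges by blast+
  show "copy n i (corner n j) \<in> copy n i ` sg_verts n" using corner_in by blast
  show "copy n i (corner n j) = copy n j (corner n i)" by (rule add.commute)
  show "e \<subseteq> copy n i ` sg_verts n \<and> card e = 2" if "e \<in> (`) (copy n i) ` sg_edges n" for e
    using that sg_edges_wf by (auto simp: card_image)
  show "copy n i ` sg_verts n \<inter> copy n j ` sg_verts n = {copy n i (corner n j)}" if "i \<noteq> j"
    using that sg_copies_Int[of n]
    by (cases i; cases j; simp add: zero_prod_def[symmetric] Int_commute)
  show "j = k" if "copy n i (corner n j) = copy n i (corner n k)"
    using that by (cases j; cases k; simp)
qed

definition num_forests :: "nat \<Rightarrow> pattern \<Rightarrow> real" where
  "num_forests n \<tau> = real (card (forests (sg_verts n) (sg_edges n) (corner n) \<tau>))"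

definition num_deg :: "nat \<Rightarrow> pattern \<Rightarrow> nat \<times> nat \<Rightarrow> nat \<Rightarrow> real" where
  "num_deg n = deg_count (sg_verts n) (sg_edges n) (corner n)"

definition num_interior :: "nat \<Rightarrow> pattern \<Rightarrow> nat \<Rightarrow> real" where
  "num_interior n \<tau> d = (\<Sum>x\<in>sg_verts n - range (corner n). num_deg n \<tau> x d)"

definition num_joint :: "nat \<Rightarrow> pattern \<Rightarrow> side \<Rightarrow> side \<Rightarrow> nat \<Rightarrow> real" where
  "num_joint n \<tau> i j m = (\<Sum>d\<le>m. mix \<tau> (\<lambda>k \<sigma>.
     if k = i then num_deg n \<sigma> (corner n j) d
     else if k = j then num_deg n \<sigma> (corner n i) (m - d) else num_forests n \<sigma>))"

lemma num_forests_Suc: "num_forests (Suc n) \<tau> = mix \<tau> (\<lambda>i. num_forests n)"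
proof -
  interpret gluing "\<lambda>i. copy n i ` sg_verts n" "\<lambda>i. (`) (copy n i) ` sg_edges n"
    "\<lambda>i j. copy n i (corner n j)" by (rule gluing_sg)
  show ?thesis
    unfolding num_forests_def sg_verts_Suc sg_edges_Suc corner_Suc card_glued_forests
    by (simp add: card_forests_image)
qed

lemma num_deg_Suc_private:
  assumes "\<And>k. k \<noteq> i \<Longrightarrow> copy n i x \<notin> copy n k ` sg_verts n"
  shows "num_deg (Suc n) \<tau> (copy n i x) d =
    mix \<tau> (\<lambda>k \<sigma>. if k = i then num_deg n \<sigma> x d else num_forests n \<sigma>)"
proof -
  interpret gluing "\<lambda>i. copy n i ` sg_verts n" "\<lambda>i. (`) (copy n i) ` sg_edges n"
    "\<lambda>i j. copy n i (corner n j)" by (rule gluing_sg)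
  have "num_deg (Suc n) \<tau> (copy n i x) d =
    mix \<tau> (\<lambda>k \<sigma>. if k = i then deg_count (copy n i ` sg_verts n) ((`) (copy n i) ` sg_edges n)
        (\<lambda>j. copy n i (corner n j)) \<sigma> (copy n i x) d
      else real (card (copy_forests k \<sigma>)))"
    unfolding num_deg_def sg_verts_Suc sg_edges_Suc corner_Suc by (rule deg_count_private[OF assms])
  then show ?thesis
    by (simp only: deg_count_image[OF inj_on_add] card_forests_image[OF inj_on_add]
        num_deg_def num_forests_def)
qed

lemma num_deg_corner_Suc:
  "num_deg (Suc n) \<tau> (corner (Suc n) i) d =
    mix \<tau> (\<lambda>k \<sigma>. if k = i then num_deg n \<sigma> (corner n i) d else num_forests n \<sigma>)"
proof -
  interpret gluing "\<lambda>i. copy n i ` sg_verts n" "\<lambda>i. (`) (copy n i) ` sg_edges n"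
    "\<lambda>i j. copy n i (corner n j)" by (rule gluing_sg)
  have "copy n i (corner n i) \<notin> copy n k ` sg_verts n" if "k \<noteq> i" for k
    using V_Int_corner[of "copy n i (corner n i)" i k] K_in[of i i] K_inj[of i i k] that by metis
  then show ?thesis unfolding corner_Suc by (rule num_deg_Suc_private)
qed

lemma num_deg_joint_Suc:
  assumes "i \<noteq> j"
  shows "num_deg (Suc n) \<tau> (copy n i (corner n j)) m = num_joint n \<tau> i j m"
proof -
  interpret gluing "\<lambda>i. copy n i ` sg_verts n" "\<lambda>i. (`) (copy n i) ` sg_edges n"
    "\<lambda>i j. copy n i (corner n j)" by (rule gluing_sg)
  have "num_deg (Suc n) \<tau> (copy n i (corner n j)) m = (\<Sum>d\<le>m. mix \<tau> (\<lambda>k \<sigma>.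
      if k = i then deg_count (copy n i ` sg_verts n) ((`) (copy n i) ` sg_edges n)
        (\<lambda>j. copy n i (corner n j)) \<sigma> (copy n i (corner n j)) d
      else if k = j then deg_count (copy n j ` sg_verts n) ((`) (copy n j) ` sg_edges n)
        (\<lambda>i. copy n j (corner n i)) \<sigma> (copy n j (corner n i)) (m - d)
      else real (card (copy_forests k \<sigma>))))"
    unfolding num_deg_def sg_verts_Suc sg_edges_Suc corner_Suc by (rule deg_count_joint[OF assms])
  then show ?thesis
    by (simp only: deg_count_image[OF inj_on_add] card_forests_image[OF inj_on_add]
        num_deg_def num_forests_def num_joint_def)
qed

lemma num_interior_Suc:
  "num_interior (Suc n) \<tau> m =
    (\<Sum>i\<in>UNIV. mix \<tau> (\<lambda>k \<sigma>. if k = i then num_interior n \<sigma> m else num_forests n \<sigma>)) +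
    (num_joint n \<tau> Lft Rgt m + num_joint n \<tau> Lft Top m + num_joint n \<tau> Rgt Top m)"
proof -
  interpret gluing "\<lambda>i. copy n i ` sg_verts n" "\<lambda>i. (`) (copy n i) ` sg_edges n"
    "\<lambda>i j. copy n i (corner n j)" by (rule gluing_sg)
  have "(\<Sum>x\<in>copy n i ` sg_verts n - range (\<lambda>j. copy n i (corner n j)). num_deg (Suc n) \<tau> x m) =
      mix \<tau> (\<lambda>k \<sigma>. if k = i then num_interior n \<sigma> m else num_forests n \<sigma>)" for i
  proof -
    have "copy n i ` sg_verts n - range (\<lambda>j. copy n i (corner n j)) =
        copy n i ` (sg_verts n - range (corner n))"
      by (simp add: image_set_diff image_comp comp_def)
    then have "(\<Sum>x\<in>copy n i ` sg_verts n - range (\<lambda>j. copy n i (corner n j)). num_deg (Suc n) \<tau> x m) =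
        (\<Sum>x\<in>sg_verts n - range (corner n). num_deg (Suc n) \<tau> (copy n i x) m)"
      by (simp add: sum.reindex)
    also have "\<dots> = (\<Sum>x\<in>sg_verts n - range (corner n).
        mix \<tau> (\<lambda>k \<sigma>. if k = i then num_deg n \<sigma> x m else num_forests n \<sigma>))"
    proof (rule sum.cong[OF refl], rule num_deg_Suc_private)
      fix x k assume x: "x \<in> sg_verts n - range (corner n)" "k \<noteq> i"
      have "copy n i x \<in> copy n i ` sg_verts n - range (\<lambda>j. copy n i (corner n j))"
        using x(1) by auto
      then show "copy n i x \<notin> copy n k ` sg_verts n" using interior_private x(2) by blast
    qed
    also have "\<dots> = mix \<tau> (\<lambda>k \<sigma>. if k = i then num_interior n \<sigma> m else num_forests n \<sigma>)"
      unfolding num_interior_def by (rule mix_sum_slot[symmetric])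
    finally show ?thesis .
  qed
  then show ?thesis
    unfolding num_interior_def[of "Suc n"] sg_verts_Suc corner_Suc sum_interior
    by (simp only: num_deg_joint_Suc[of Lft Rgt] num_deg_joint_Suc[of Lft Top]
        num_deg_joint_Suc[of Rgt Top] side.distinct not_False_eq_True)
qed

text \<open>The edge opposite the corner \<open>i\<close>, indexed so that
  \<open>{base_edge k}\<close> has the pattern \<open>Off k\<close>.\<close>

definition base_edge :: "side \<Rightarrow> (nat \<times> nat) set" where
  "base_edge i = corner 0 ` (UNIV - {i})"

lemma base_edge_simps:
  "base_edge Lft = {(1, 0), (0, 1)}" "base_edge Rgt = {(0, 0), (0, 1)}" "base_edge Top = {(0, 0), (1, 0)}"
proof -
  have "UNIV - {Lft} = {Rgt, Top}" "UNIV - {Rgt} = {Lft, Top}" "UNIV - {Top} = {Lft, Rgt}"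
    by (auto simp: UNIV_side)
  then show "base_edge Lft = {(1, 0), (0, 1)}" "base_edge Rgt = {(0, 0), (0, 1)}"
    "base_edge Top = {(0, 0), (1, 0)}"
    by (simp_all add: base_edge_def)
qed

lemma sg_edges_0: "sg_edges 0 = {base_edge Lft, base_edge Rgt, base_edge Top}"
  by (auto simp: base_edge_simps)

lemma corner_0_inject: "corner 0 i = corner 0 j \<longleftrightarrow> i = j"
  by (cases i; cases j) simp_all

lemma corner_in_base_edge: "corner 0 i \<in> base_edge j \<longleftrightarrow> i \<noteq> j"
  by (auto simp: base_edge_def corner_0_inject)

lemma base_edge_inject: "base_edge i = base_edge j \<longleftrightarrow> i = j"
  using corner_in_base_edge by metis

lemma base_edge_eq: "i \<noteq> j \<Longrightarrow> i \<noteq> k \<Longrightarrow> j \<noteq> k \<Longrightarrow> {corner 0 i, corner 0 j} = base_edge k"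
  by (cases i; cases j; cases k; simp add: base_edge_simps insert_commute)

lemma sg_verts_0: "sg_verts 0 = range (corner 0)"
  by (simp add: UNIV_side)

declare sg_verts.simps [simp del] sg_edges.simps [simp del]

lemma conn_single_iff: "conn {{u, v}} x y \<longleftrightarrow> x = y \<or> {x, y} = {u, v}"
proof
  show "x = y \<or> {x, y} = {u, v}" if "conn {{u, v}} x y"
    using that by (induction rule: rtrancl_induct) (auto simp: doubleton_eq_iff)
  show "conn {{u, v}} x y" if "x = y \<or> {x, y} = {u, v}"
    using that conn_edge[of x y "{{u, v}}"] by auto
qed

lemma covers_base_iff:
  "covers (sg_verts 0) (corner 0) \<tau> T \<longleftrightarrow> (\<forall>i j. conn T (corner 0 i) (corner 0 j) \<longleftrightarrow> linked \<tau> i j)"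
  by (auto simp: covers_def sg_verts_0)

lemma covers_base_empty: "covers (sg_verts 0) (corner 0) Apart {}"
proof -
  have "adjacency {} = ({} :: ((nat \<times> nat) \<times> (nat \<times> nat)) set)" by (simp add: adjacency_def)
  then show ?thesis by (simp add: covers_base_iff corner_0_inject)
qed

lemma covers_base_single: "covers (sg_verts 0) (corner 0) (Off k) {base_edge k}"
proof -
  have "conn {base_edge k} (corner 0 i) (corner 0 j) \<longleftrightarrow> linked (Off k) i j" for i j
    by (cases k; cases i; cases j; simp add: base_edge_simps conn_single_iff doubleton_eq_iff)
  then show ?thesis by (simp add: covers_base_iff)
qed

lemma covers_base_two:
  assumes "base_edge k \<in> T" "base_edge l \<in> T" "k \<noteq> l"
  shows "covers (sg_verts 0) (corner 0) Joined T"
proof -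
  have joined: "conn T (corner 0 i) (corner 0 j)" if "base_edge m \<in> T" "i \<noteq> m" "j \<noteq> m" for i j m
  proof (cases "i = j")
    case False
    then show ?thesis using that base_edge_eq[of i j m] conn_edge by metis
  qed simp
  obtain m where m: "m \<noteq> k" "m \<noteq> l" by (cases k; cases l; auto)
  have "conn T (corner 0 i) (corner 0 m)" for i
    using joined[OF assms(1), of i m] joined[OF assms(2), of i m] m assms(3) by metis
  then have "conn T (corner 0 i) (corner 0 j)" for i j
    using conn_sym rtrancl_trans by metis
  then show ?thesis by (simp add: covers_base_iff)
qed

text \<open>All eight sets of edges of the triangle are tested. The full triangle connects the
  corners as well but is excluded from \<open>Joined\<close> by its edge count.\<close>

lemma sg_forests_0:
  "forests (sg_verts 0) (sg_edges 0) (corner 0) Joined =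
     {{base_edge Lft, base_edge Rgt}, {base_edge Lft, base_edge Top}, {base_edge Rgt, base_edge Top}}"
  "forests (sg_verts 0) (sg_edges 0) (corner 0) (Off k) = {{base_edge k}}"
  "forests (sg_verts 0) (sg_edges 0) (corner 0) Apart = {{}}"
proof -
  let ?L = "base_edge Lft" and ?R = "base_edge Rgt" and ?T = "base_edge Top"
  have sub: "T \<subseteq> sg_edges 0 \<longleftrightarrow>
      T \<in> {{}, {?L}, {?R}, {?T}, {?L, ?R}, {?L, ?T}, {?R, ?T}, {?L, ?R, ?T}}" for T
  proof
    assume "T \<subseteq> sg_edges 0"
    then have "T = (if ?L \<in> T then {?L} else {}) \<union> (if ?R \<in> T then {?R} else {}) \<union>
        (if ?T \<in> T then {?T} else {})"
      unfolding sg_edges_0 by auto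
    then obtain a b c where "T = (if a then {?L} else {}) \<union> (if b then {?R} else {}) \<union>
        (if c then {?T} else {})" by metis
    then show "T \<in> {{}, {?L}, {?R}, {?T}, {?L, ?R}, {?L, ?T}, {?R, ?T}, {?L, ?R, ?T}}"
      by (cases a; cases b; cases c; simp add: insert_commute)
  qed (auto simp: sg_edges_0)
  have card: "card (sg_verts 0) = 3" by (simp add: sg_verts.simps)
  have pat: "covers (sg_verts 0) (corner 0) \<tau> T \<longleftrightarrow> \<tau> = \<sigma>"
    if "covers (sg_verts 0) (corner 0) \<sigma> T" for \<sigma> \<tau> T
    using that covers_pattern_unique by metis
  note covers = pat[OF covers_base_empty] pat[OF covers_base_single]
    pat[OF covers_base_two[of Lft "{?L, ?R}" Rgt], simplified]
    pat[OF covers_base_two[of Lft "{?L, ?T}" Top], simplified]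
    pat[OF covers_base_two[of Rgt "{?R, ?T}" Top], simplified]
    pat[OF covers_base_two[of Lft "{?L, ?R, ?T}" Rgt], simplified]
  have forests: "T \<in> forests (sg_verts 0) (sg_edges 0) (corner 0) \<tau> \<longleftrightarrow>
      T = {} \<and> \<tau> = Apart \<or> T = {?L} \<and> \<tau> = Off Lft \<or> T = {?R} \<and> \<tau> = Off Rgt \<or>
      T = {?T} \<and> \<tau> = Off Top \<or> T \<in> {{?L, ?R}, {?L, ?T}, {?R, ?T}} \<and> \<tau> = Joined" for T \<tau>
  proof
    assume "T \<in> forests (sg_verts 0) (sg_edges 0) (corner 0) \<tau>"
    then have T: "T \<in> {{}, {?L}, {?R}, {?T}, {?L, ?R}, {?L, ?T}, {?R, ?T}, {?L, ?R, ?T}}"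
      "covers (sg_verts 0) (corner 0) \<tau> T" "card T + blocks \<tau> = 3"
      by (simp_all only: forests_def mem_Collect_eq sub card)
    from T(1) show "T = {} \<and> \<tau> = Apart \<or> T = {?L} \<and> \<tau> = Off Lft \<or> T = {?R} \<and> \<tau> = Off Rgt \<or>
      T = {?T} \<and> \<tau> = Off Top \<or> T \<in> {{?L, ?R}, {?L, ?T}, {?R, ?T}} \<and> \<tau> = Joined"
      unfolding insert_iff empty_iff
      by (elim disjE) (use T(2,3) in \<open>simp_all add: covers base_edge_inject\<close>)
  next
    assume "T = {} \<and> \<tau> = Apart \<or> T = {?L} \<and> \<tau> = Off Lft \<or> T = {?R} \<and> \<tau> = Off Rgt \<or>
      T = {?T} \<and> \<tau> = Off Top \<or> T \<in> {{?L, ?R}, {?L, ?T}, {?R, ?T}} \<and> \<tau> = Joined"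
    then show "T \<in> forests (sg_verts 0) (sg_edges 0) (corner 0) \<tau>"
      unfolding forests_def mem_Collect_eq sub card insert_iff empty_iff
      by (elim disjE conjE) (simp_all add: covers base_edge_inject)
  qed
  show "forests (sg_verts 0) (sg_edges 0) (corner 0) Joined = {{?L, ?R}, {?L, ?T}, {?R, ?T}}"
    "forests (sg_verts 0) (sg_edges 0) (corner 0) (Off k) = {{base_edge k}}"
    "forests (sg_verts 0) (sg_edges 0) (corner 0) Apart = {{}}"
    subgoal by (rule set_eqI) (simp add: forests)
    subgoal by (rule set_eqI) (cases k; simp add: forests)
    subgoal by (rule set_eqI) (simp add: forests)
    done
qed

lemma degree_in_insert:
  "finite T \<Longrightarrow> e \<notin> T \<Longrightarrow> degree_in (insert e T) x = of_bool (x \<in> e) + degree_in T x"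
proof -
  assume T: "finite T" "e \<notin> T"
  have "{f \<in> insert e T. x \<in> f} = (if x \<in> e then insert e {f \<in> T. x \<in> f} else {f \<in> T. x \<in> f})"
    by auto
  then show ?thesis using T by (simp add: degree_in_def)
qed

lemma degree_in_empty: "degree_in {} x = 0"
  by (simp add: degree_in_def)

lemma num_forests_0:
  "num_forests 0 Joined = 3" "num_forests 0 (Off k) = 1" "num_forests 0 Apart = 1"
proof -
  have "{base_edge Lft, base_edge Rgt} \<noteq> {base_edge Lft, base_edge Top}"
    "{base_edge Lft, base_edge Rgt} \<noteq> {base_edge Rgt, base_edge Top}"
    "{base_edge Lft, base_edge Top} \<noteq> {base_edge Rgt, base_edge Top}"
    by (simp_all add: doubleton_eq_iff base_edge_inject)
  then show "num_forests 0 Joined = 3" unfolding num_forests_def sg_forests_0 by simp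
qed (simp_all add: num_forests_def sg_forests_0)

text \<open>A spanning tree of the triangle is a path with two edges; a given corner is an end of
  two of these paths and the middle of the third.\<close>

lemma num_deg_0:
  "num_deg 0 Joined (corner 0 i) d = 2 * of_bool (d = 1) + of_bool (d = 2)"
  "num_deg 0 (Off k) (corner 0 i) d = of_bool (d = of_bool (i \<noteq> k))"
  "num_deg 0 Apart (corner 0 i) d = of_bool (d = 0)"
proof -
  note eq = num_deg_def deg_count_eq_sum[OF finite_sg_edges] sg_forests_0
  have "{base_edge Lft, base_edge Rgt} \<noteq> {base_edge Lft, base_edge Top}"
    "{base_edge Lft, base_edge Rgt} \<noteq> {base_edge Rgt, base_edge Top}"
    "{base_edge Lft, base_edge Top} \<noteq> {base_edge Rgt, base_edge Top}"
    by (simp_all add: doubleton_eq_iff base_edge_inject)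
  then show "num_deg 0 Joined (corner 0 i) d = 2 * of_bool (d = 1) + of_bool (d = 2)"
    unfolding eq
    by (cases i) (auto simp: degree_in_insert degree_in_empty base_edge_inject corner_in_base_edge
        simp del: corner.simps)
  show "num_deg 0 (Off k) (corner 0 i) d = of_bool (d = of_bool (i \<noteq> k))"
    "num_deg 0 Apart (corner 0 i) d = of_bool (d = 0)"
    unfolding eq by (auto simp: degree_in_insert degree_in_empty corner_in_base_edge)
qed

lemma num_interior_0: "num_interior 0 \<tau> d = 0"
  by (simp add: num_interior_def sg_verts_0)

section \<open>Normalised counts\<close>

lemma mix_simps:
  "mix Joined F =
     F Lft Joined * (F Rgt Joined * F Top (Off Lft) + F Rgt Joined * F Top (Off Rgt) +
       F Rgt (Off Lft) * F Top Joined + F Rgt (Off Top) * F Top Joined) +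
     F Lft (Off Rgt) * (F Rgt Joined * F Top Joined) +
     F Lft (Off Top) * (F Rgt Joined * F Top Joined)"
  "mix (Off Lft) F =
     F Lft Joined * (F Rgt (Off Lft) * F Top (Off Lft)) +
     F Lft (Off Lft) * (F Rgt Joined * F Top (Off Lft) + F Rgt Joined * F Top (Off Rgt) +
       F Rgt (Off Lft) * F Top Joined + F Rgt (Off Top) * F Top Joined) +
     F Lft (Off Rgt) * (F Rgt Joined * F Top (Off Lft)) +
     F Lft (Off Top) * (F Rgt (Off Lft) * F Top Joined) +
     F Lft Apart * (F Rgt Joined * F Top Joined)"
  "mix (Off Rgt) F =
     F Lft Joined * (F Rgt (Off Lft) * F Top (Off Rgt) + F Rgt (Off Rgt) * F Top (Off Lft) +
       F Rgt (Off Rgt) * F Top (Off Rgt) + F Rgt Apart * F Top Joined) +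
     F Lft (Off Rgt) * (F Rgt Joined * F Top (Off Rgt) + F Rgt (Off Rgt) * F Top Joined +
       F Rgt (Off Top) * F Top Joined) +
     F Lft (Off Top) * (F Rgt (Off Rgt) * F Top Joined)"
  "mix (Off Top) F =
     F Lft Joined * (F Rgt Joined * F Top Apart + F Rgt (Off Lft) * F Top (Off Top) +
       F Rgt (Off Top) * F Top (Off Lft) + F Rgt (Off Top) * F Top (Off Top)) +
     F Lft (Off Rgt) * (F Rgt Joined * F Top (Off Top)) +
     F Lft (Off Top) * (F Rgt Joined * F Top (Off Rgt) + F Rgt Joined * F Top (Off Top) +
       F Rgt (Off Top) * F Top Joined)"
  "mix Apart F =
     F Lft Joined * (F Rgt (Off Lft) * F Top Apart + F Rgt (Off Rgt) * F Top Apart +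
       F Rgt Apart * F Top (Off Lft) + F Rgt Apart * F Top (Off Top)) +
     F Lft (Off Lft) * (F Rgt Joined * F Top Apart + F Rgt (Off Lft) * F Top (Off Rgt) +
       F Rgt (Off Lft) * F Top (Off Top) + F Rgt (Off Rgt) * F Top (Off Lft) +
       F Rgt (Off Rgt) * F Top (Off Rgt) + F Rgt (Off Top) * F Top (Off Lft) +
       F Rgt (Off Top) * F Top (Off Top) + F Rgt Apart * F Top Joined) +
     F Lft (Off Rgt) * (F Rgt Joined * F Top Apart + F Rgt (Off Rgt) * F Top (Off Lft) +
       F Rgt (Off Rgt) * F Top (Off Top) + F Rgt (Off Top) * F Top (Off Lft) +
       F Rgt (Off Top) * F Top (Off Top)) +
     F Lft (Off Top) * (F Rgt (Off Lft) * F Top (Off Rgt) +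
       F Rgt (Off Lft) * F Top (Off Top) + F Rgt (Off Rgt) * F Top (Off Rgt) +
       F Rgt (Off Rgt) * F Top (Off Top) + F Rgt Apart * F Top Joined) +
     F Lft Apart * (F Rgt Joined * F Top (Off Rgt) + F Rgt Joined * F Top (Off Top) +
       F Rgt (Off Rgt) * F Top Joined + F Rgt (Off Top) * F Top Joined)"
  by (simp_all add: mix_def algebra_simps)

fun weight :: "pattern \<Rightarrow> real" where
  "weight Joined = 1"
| "weight (Off k) = 1"
| "weight Apart = 3"

text \<open>The table has 6 triples for \<open>Joined\<close>; 8 for each \<open>Off k\<close>, one
  of which contains \<open>Apart\<close>; and 26 for \<open>Apart\<close>, 12 of which contain
  \<open>Apart\<close>. As \<open>Apart\<close> weighs 3, the totals are 6, 7 + 3 and 14 +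
  36.\<close>

fun total_weight :: "pattern \<Rightarrow> real" where
  "total_weight Joined = 6"
| "total_weight (Off k) = 10"
| "total_weight Apart = 50"

text \<open>The mean of a product over the three copies, for a triple of patterns drawn from the
  table with probability proportional to its weight. By \<open>mix_num_forests\<close> this is the
  law of the patterns obtained by cutting a uniform forest, and it is the same at every
  level.\<close>

definition expect :: "pattern \<Rightarrow> (side \<Rightarrow> pattern \<Rightarrow> real) \<Rightarrow> real" where
  "expect \<tau> G = mix \<tau> (\<lambda>i \<sigma>. weight \<sigma> * G i \<sigma>) / total_weight \<tau>"

lemma mix_weight: "mix \<tau> (\<lambda>i. weight) = total_weight \<tau>"
  by (cases \<tau> rule: pattern_cases) (simp_all add: mix_simps)

definition ratio :: "nat \<Rightarrow> real" where
  "ratio n = (5 / 3) ^ n / 3"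

lemma blocks_ge_1: "1 \<le> blocks \<tau>"
  by (cases \<tau>) simp_all

text \<open>Tightness of the block count makes the exponents \<open>blocks - 1\<close> of the three
  copies add up to \<open>blocks \<tau>\<close> for every triple in the table, so the power of
  \<open>ratio n\<close> factors out.\<close>

lemma mix_num_forests_aux:
  assumes "\<And>\<sigma>. num_forests n \<sigma> = num_forests n Joined * weight \<sigma> * ratio n ^ (blocks \<sigma> - 1)"
  shows "mix \<tau> (\<lambda>i \<sigma>. num_forests n \<sigma> * G i \<sigma>) =
    num_forests n Joined ^ 3 * ratio n ^ blocks \<tau> * mix \<tau> (\<lambda>i \<sigma>. weight \<sigma> * G i \<sigma>)"
proof -
  have "num_forests n p * G Lft p * (num_forests n q * G Rgt q) * (num_forests n r * G Top r) =
      num_forests n Joined ^ 3 * ratio n ^ blocks \<tau> *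
      (weight p * G Lft p * (weight q * G Rgt q) * (weight r * G Top r))"
    if pqr: "(p, q, r) \<in> glue_table \<tau>" for p q r
  proof -
    define \<sigma> where "\<sigma> i = (case i of Lft \<Rightarrow> p | Rgt \<Rightarrow> q | Top \<Rightarrow> r)" for i
    have "blocks p + blocks q + blocks r = blocks \<tau> + 3"
      using compatible_tight_iff[of \<sigma> \<tau>] pqr by (simp add: \<sigma>_def)
    moreover have "1 \<le> blocks p" "1 \<le> blocks q" "1 \<le> blocks r"
      by (rule blocks_ge_1)+
    ultimately have "blocks \<tau> = (blocks p - 1) + (blocks q - 1) + (blocks r - 1)" by arith
    then show ?thesis
      unfolding assms[of p] assms[of q] assms[of r]
      by (simp add: power_add power3_eq_cube algebra_simps)
  qed
  then show ?thesis unfolding mix_def sum_distrib_left by (intro sum.cong refl) auto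
qed

lemma num_forests_eq:
  "num_forests n Joined > 0 \<and>
    (\<forall>\<sigma>. num_forests n \<sigma> = num_forests n Joined * weight \<sigma> * ratio n ^ (blocks \<sigma> - 1))"
proof (induction n)
  case 0
  have "num_forests 0 \<sigma> = num_forests 0 Joined * weight \<sigma> * ratio 0 ^ (blocks \<sigma> - 1)" for \<sigma>
    by (cases \<sigma>) (simp_all add: num_forests_0 ratio_def power2_eq_square)
  then show ?case by (simp add: num_forests_0)
next
  case (Suc n)
  have eq: "num_forests (Suc n) \<sigma> = num_forests n Joined ^ 3 * ratio n ^ blocks \<sigma> * total_weight \<sigma>"
    for \<sigma>
    using mix_num_forests_aux[of n \<sigma> "\<lambda>_ _. 1", OF conjunct2[OF Suc.IH, THEN spec]]
    unfolding num_forests_Suc by (simp only: mult_1_right mix_weight)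
  have "ratio n > 0" by (simp add: ratio_def)
  moreover have "num_forests (Suc n) \<sigma> =
      num_forests (Suc n) Joined * weight \<sigma> * ratio (Suc n) ^ (blocks \<sigma> - 1)" for \<sigma>
    unfolding eq by (cases \<sigma>) (simp_all add: ratio_def power2_eq_square power3_eq_cube field_simps)
  ultimately show ?case using conjunct1[OF Suc.IH] eq[of Joined] by simp
qed

lemma num_forests_pos: "num_forests n \<tau> > 0"
proof -
  have "weight \<tau> > 0" "ratio n > 0" by (cases \<tau>) (simp_all add: ratio_def)
  then show ?thesis using num_forests_eq[of n] by (metis mult_pos_pos zero_less_power)
qed

lemma mix_num_forests:
  "mix \<tau> (\<lambda>i \<sigma>. num_forests n \<sigma> * G i \<sigma>) = num_forests (Suc n) \<tau> * expect \<tau> G"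
proof -
  note aux = mix_num_forests_aux[OF conjunct2[OF num_forests_eq, THEN spec]]
  have "num_forests (Suc n) \<tau> = num_forests n Joined ^ 3 * ratio n ^ blocks \<tau> * total_weight \<tau>"
    using aux[of \<tau> n "\<lambda>_ _. 1"] unfolding num_forests_Suc by (simp only: mult_1_right mix_weight)
  moreover have "total_weight \<tau> \<noteq> 0" by (cases \<tau>) simp_all
  ultimately show ?thesis unfolding aux expect_def by simp
qed

section \<open>Degree distributions\<close>

text \<open>
  The normalised degree distribution of a corner, depending on whether the pattern is \<open>Joined\<close>, cuts
  off this corner alone, cuts off another corner, or is \<open>Apart\<close>. The formulas solve the linear
  recursion \<open>expect_corner_deg\<close> with the initial values \<open>num_deg_0\<close>.
\<close>

definition joined_deg :: "nat \<Rightarrow> nat \<Rightarrow> real" where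
  "joined_deg n d = (if d = 1 then 11/14 - 5/42 * (1/15) ^ n
    else if d = 2 then 3/14 + 5/42 * (1/15) ^ n else 0)"

definition alone_deg :: "nat \<Rightarrow> nat \<Rightarrow> real" where
  "alone_deg n d =
    (if d = 0 then 33/28 * (3/5) ^ n - 5/28 * (1/25) ^ n
     else if d = 1 then 11/14 - 2/7 * (1/15) ^ n - 6/7 * (3/5) ^ n + 5/14 * (1/25) ^ n
     else if d = 2 then 3/14 + 2/7 * (1/15) ^ n - 9/28 * (3/5) ^ n - 5/28 * (1/25) ^ n else 0)"

definition paired_deg :: "nat \<Rightarrow> nat \<Rightarrow> real" where
  "paired_deg n d = (if d = 1 then 11/14 + 3/14 * (1/15) ^ n
    else if d = 2 then 3/14 - 3/14 * (1/15) ^ n else 0)"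

definition apart_deg :: "nat \<Rightarrow> nat \<Rightarrow> real" where
  "apart_deg n d =
    (if d = 0 then 11/14 * (3/5) ^ n + 3/14 * (1/25) ^ n
     else if d = 1 then 11/14 + 3/14 * (1/15) ^ n - 4/7 * (3/5) ^ n - 3/7 * (1/25) ^ n
     else if d = 2 then 3/14 - 3/14 * (1/15) ^ n - 3/14 * (3/5) ^ n + 3/14 * (1/25) ^ n else 0)"

lemmas deg_defs = joined_deg_def alone_deg_def paired_deg_def apart_deg_def

fun corner_deg :: "nat \<Rightarrow> pattern \<Rightarrow> side \<Rightarrow> nat \<Rightarrow> real" where
  "corner_deg n Joined i d = joined_deg n d"
| "corner_deg n (Off k) i d = (if i = k then alone_deg n d else paired_deg n d)"
| "corner_deg n Apart i d = apart_deg n d"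

lemma expect_corner_deg:
  "expect \<tau> (\<lambda>k \<sigma>. if k = i then corner_deg n \<sigma> i d else 1) = corner_deg (Suc n) \<tau> i d"
proof -
  \<comment> \<open>The coefficients are the weighted numbers of triples according to the pattern of
    the copy that holds the corner. \<open>J\<close> and \<open>P\<close> form a closed system with
    eigenvalues 1 and 1/15; \<open>alone_deg\<close> and \<open>apart_deg\<close> contribute the
    eigenvalues 3/5 and 1/25.\<close>
  have J: "4 * joined_deg n d + 2 * paired_deg n d = 6 * joined_deg (Suc n) d"
    by (simp add: deg_defs)
  have P: "6 * joined_deg n d + 4 * paired_deg n d = 10 * paired_deg (Suc n) d"
    by (simp add: deg_defs)
  have A: "joined_deg n d + 4 * alone_deg n d + 2 * paired_deg n d + 3 * apart_deg n d =
      10 * alone_deg (Suc n) d"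
    by (simp add: deg_defs)
  have H: "12 * joined_deg n d + 12 * alone_deg n d + 14 * paired_deg n d + 12 * apart_deg n d =
      50 * apart_deg (Suc n) d"
    by (simp add: deg_defs)
  show ?thesis
    using J P A H
    by (cases \<tau> rule: pattern_cases; cases i; simp add: expect_def mix_simps)
qed

lemma num_deg_corner: "num_deg n \<tau> (corner n i) d = num_forests n \<tau> * corner_deg n \<tau> i d"
proof (induction n arbitrary: \<tau>)
  case 0
  have "d = 0 \<or> d = 1 \<or> d = 2 \<or> d > 2" by linarith
  then show ?case by (cases \<tau>) (auto simp: num_deg_0 num_forests_0 deg_defs)
next
  case (Suc n)
  have "num_deg (Suc n) \<tau> (corner (Suc n) i) d =
      mix \<tau> (\<lambda>k \<sigma>. num_forests n \<sigma> * (if k = i then corner_deg n \<sigma> i d else 1))"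
    unfolding num_deg_corner_Suc Suc.IH by (intro arg_cong2[where f = mix] refl ext) simp
  then show ?case unfolding mix_num_forests expect_corner_deg .
qed

section \<open>Degrees of joints and inner vertices\<close>

text \<open>Here \<open>n\<close> is the level of the copies, while \<open>\<tau>\<close> is the
  pattern at level \<open>Suc n\<close>. The joint has degree \<open>d\<close> in the copy
  \<open>i\<close>, where it is the corner \<open>j\<close>, and degree \<open>e\<close> in the copy
  \<open>j\<close>.\<close>

definition joint_deg :: "nat \<Rightarrow> pattern \<Rightarrow> side \<Rightarrow> side \<Rightarrow> nat \<Rightarrow> nat \<Rightarrow> real" where
  "joint_deg n \<tau> i j d e = expect \<tau> (\<lambda>k \<sigma>.
     if k = i then corner_deg n \<sigma> j d else if k = j then corner_deg n \<sigma> i e else 1)"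

definition joints_deg :: "nat \<Rightarrow> pattern \<Rightarrow> nat \<Rightarrow> real" where
  "joints_deg n \<tau> m = (\<Sum>d\<le>m. joint_deg n \<tau> Lft Rgt d (m - d) + joint_deg n \<tau> Lft Top d (m - d) +
     joint_deg n \<tau> Rgt Top d (m - d))"

text \<open>The expected number of vertices of degree \<open>m\<close>, the three corners left out,
  in a uniform random forest of pattern \<open>\<tau>\<close>.\<close>

definition interior_deg :: "nat \<Rightarrow> pattern \<Rightarrow> nat \<Rightarrow> real" where
  "interior_deg n \<tau> m = num_interior n \<tau> m / num_forests n \<tau>"

lemma num_joint_eq:
  "num_joint n \<tau> i j m = num_forests (Suc n) \<tau> * (\<Sum>d\<le>m. joint_deg n \<tau> i j d (m - d))"
proof -
  have "mix \<tau> (\<lambda>k \<sigma>. if k = i then num_deg n \<sigma> (corner n j) d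
      else if k = j then num_deg n \<sigma> (corner n i) (m - d) else num_forests n \<sigma>) =
      num_forests (Suc n) \<tau> * joint_deg n \<tau> i j d (m - d)" for d
    unfolding joint_deg_def mix_num_forests[symmetric] num_deg_corner
    by (intro arg_cong2[where f = mix] refl ext) simp
  then show ?thesis unfolding num_joint_def sum_distrib_left by (intro sum.cong refl)
qed

lemma joints_deg_eq:
  "num_joint n \<tau> Lft Rgt m + num_joint n \<tau> Lft Top m + num_joint n \<tau> Rgt Top m =
    num_forests (Suc n) \<tau> * joints_deg n \<tau> m"
  unfolding num_joint_eq joints_deg_def sum.distrib by (simp only: distrib_left)

lemma num_deg_bounds: "0 \<le> num_deg n \<tau> x d \<and> num_deg n \<tau> x d \<le> num_forests n \<tau>"
proof -
  have "card {T \<in> forests (sg_verts n) (sg_edges n) (corner n) \<tau>. degree_in T x = d} \<le>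
      card (forests (sg_verts n) (sg_edges n) (corner n) \<tau>)"
    by (rule card_mono) (auto simp: finite_forests finite_sg_edges)
  then show ?thesis by (simp add: num_deg_def deg_count_def num_forests_def)
qed

lemma joints_deg_bounds: "0 \<le> joints_deg n \<tau> m" "joints_deg n \<tau> m \<le> 3"
proof -
  have "0 \<le> num_joint n \<tau> i j m \<and> num_joint n \<tau> i j m \<le> num_forests (Suc n) \<tau>" if "i \<noteq> j" for i j
    using num_deg_bounds[of "Suc n" \<tau> "copy n i (corner n j)" m]
    unfolding num_deg_joint_Suc[OF that] .
  from this[of Lft Rgt] this[of Lft Top] this[of Rgt Top]
  have "0 \<le> num_forests (Suc n) \<tau> * joints_deg n \<tau> m"
    "num_forests (Suc n) \<tau> * joints_deg n \<tau> m \<le> num_forests (Suc n) \<tau> * 3"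
    unfolding joints_deg_eq[symmetric] by simp_all
  then show "0 \<le> joints_deg n \<tau> m" "joints_deg n \<tau> m \<le> 3"
    using num_forests_pos[of "Suc n" \<tau>] by (simp_all add: zero_le_mult_iff)
qed

lemma interior_deg_Suc:
  "interior_deg (Suc n) \<tau> m =
    (\<Sum>i\<in>UNIV. expect \<tau> (\<lambda>k \<sigma>. if k = i then interior_deg n \<sigma> m else 1)) + joints_deg n \<tau> m"
proof -
  have "num_forests n \<sigma> \<noteq> 0" for \<sigma> using num_forests_pos[of n \<sigma>] by simp
  then have int: "num_interior n \<sigma> m = num_forests n \<sigma> * interior_deg n \<sigma> m" for \<sigma>
    by (simp add: interior_deg_def)
  have "mix \<tau> (\<lambda>k \<sigma>. if k = i then num_interior n \<sigma> m else num_forests n \<sigma>) =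
      num_forests (Suc n) \<tau> * expect \<tau> (\<lambda>k \<sigma>. if k = i then interior_deg n \<sigma> m else 1)" for i
    unfolding mix_num_forests[symmetric] int by (intro arg_cong2[where f = mix] refl ext) simp
  then have "num_interior (Suc n) \<tau> m = num_forests (Suc n) \<tau> *
      ((\<Sum>i\<in>UNIV. expect \<tau> (\<lambda>k \<sigma>. if k = i then interior_deg n \<sigma> m else 1)) + joints_deg n \<tau> m)"
    unfolding num_interior_Suc joints_deg_eq by (simp only: sum_distrib_left distrib_left)
  then show ?thesis using num_forests_pos[of "Suc n" \<tau>] unfolding interior_deg_def by simp
qed

lemma interior_deg_0: "interior_deg 0 \<tau> m = 0"
  by (simp add: interior_deg_def num_interior_0)

text \<open>Averaging over the three \<open>Off\<close> patterns closes the linear system in three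
  unknowns directly from the table, in place of an appeal to rotational symmetry.\<close>

definition off_mean :: "(pattern \<Rightarrow> real) \<Rightarrow> real" where
  "off_mean h = (h (Off Lft) + h (Off Rgt) + h (Off Top)) / 3"

text \<open>Each row of coefficients sums to 3, the number of copies, so the constant vector is the
  right eigenvector for 3. The other eigenvalues are 1 and 3/25.\<close>

lemma interior_deg_system:
  fixes m :: nat
  defines "a n \<equiv> interior_deg n Joined m" and "b n \<equiv> off_mean (\<lambda>\<tau>. interior_deg n \<tau> m)"
    and "c n \<equiv> interior_deg n Apart m"
  shows "a (Suc n) = 2 * a n + b n + joints_deg n Joined m"
    "b (Suc n) = 13/10 * a n + 7/5 * b n + 3/10 * c n + off_mean (\<lambda>\<tau>. joints_deg n \<tau> m)"
    "c (Suc n) = 18/25 * a n + 39/25 * b n + 18/25 * c n + joints_deg n Apart m"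
  unfolding a_def b_def c_def off_mean_def interior_deg_Suc sum_side expect_def mix_simps
  by (simp_all add: field_simps)

text \<open>
  The weights \<open>53, 38, 5\<close> form a left eigenvector, for the eigenvalue 3, of the linear system
  \<open>interior_deg_system\<close>.
\<close>

definition eigen_mean :: "(pattern \<Rightarrow> real) \<Rightarrow> real" where
  "eigen_mean h = (53 * h Joined + 38 * off_mean h + 5 * h Apart) / 96"

lemma eigen_mean_interior_Suc:
  "eigen_mean (\<lambda>\<tau>. interior_deg (Suc n) \<tau> m) =
    3 * eigen_mean (\<lambda>\<tau>. interior_deg n \<tau> m) + eigen_mean (\<lambda>\<tau>. joints_deg n \<tau> m)"
  unfolding eigen_mean_def interior_deg_system by (simp add: field_simps)

lemma convex_step_bound:
  fixes x y p q k :: real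
  assumes "0 \<le> s" "0 \<le> t" "s + t = 1" "\<bar>x\<bar> \<le> k" "\<bar>y\<bar> \<le> k" "0 \<le> p" "p \<le> c" "0 \<le> q" "q \<le> c"
  shows "\<bar>s * x + t * y + (p - q)\<bar> \<le> k + c"
proof -
  have "\<bar>s * x + t * y\<bar> \<le> s * k + t * k"
    using assms(1,2) mult_left_mono[OF assms(4,1)] mult_left_mono[OF assms(5,2)]
      abs_triangle_ineq[of "s * x" "t * y"] by (simp add: abs_mult)
  also have "\<dots> = k" using assms(3) by (simp add: distrib_right[symmetric])
  finally show ?thesis using assms(6-9) by linarith
qed

text \<open>The new differences between patterns are convex combinations of the old ones plus a
  difference of two forcing terms in [0, 3], so they grow by at most 3 per level.\<close>

lemma interior_deg_close:
  "\<bar>interior_deg n Joined m - eigen_mean (\<lambda>\<tau>. interior_deg n \<tau> m)\<bar> \<le> 3 * real n"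
proof -
  define a b c where "a n = interior_deg n Joined m" and "b n = off_mean (\<lambda>\<tau>. interior_deg n \<tau> m)"
    and "c n = interior_deg n Apart m" for n
  note step = interior_deg_system[of _ m, folded a_def b_def c_def]
  have "\<bar>a n - b n\<bar> \<le> 3 * real n \<and> \<bar>b n - c n\<bar> \<le> 3 * real n"
  proof (induction n)
    case 0
    show ?case by (simp add: a_def b_def c_def off_mean_def interior_deg_0)
  next
    case (Suc n)
    have off: "0 \<le> off_mean (\<lambda>\<tau>. joints_deg n \<tau> m)" "off_mean (\<lambda>\<tau>. joints_deg n \<tau> m) \<le> 3"
      using joints_deg_bounds[of n "Off Lft" m] joints_deg_bounds[of n "Off Rgt" m]
        joints_deg_bounds[of n "Off Top" m] by (simp_all add: off_mean_def)
    have "a (Suc n) - b (Suc n) = 7/10 * (a n - b n) + 3/10 * (b n - c n) +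
        (joints_deg n Joined m - off_mean (\<lambda>\<tau>. joints_deg n \<tau> m))"
      unfolding step by (simp add: field_simps)
    then have "\<bar>a (Suc n) - b (Suc n)\<bar> \<le> 3 * real n + 3"
      by (elim ssubst, intro convex_step_bound) (use Suc.IH off joints_deg_bounds in auto)
    moreover have "b (Suc n) - c (Suc n) = 29/50 * (a n - b n) + 21/50 * (b n - c n) +
        (off_mean (\<lambda>\<tau>. joints_deg n \<tau> m) - joints_deg n Apart m)"
      unfolding step by (simp add: field_simps)
    then have "\<bar>b (Suc n) - c (Suc n)\<bar> \<le> 3 * real n + 3"
      by (elim ssubst, intro convex_step_bound) (use Suc.IH off joints_deg_bounds in auto)
    ultimately show ?case by (simp add: algebra_simps)
  qed
  then have x: "\<bar>a n - b n\<bar> \<le> 3 * real n" and y: "\<bar>b n - c n\<bar> \<le> 3 * real n" by blast+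
  have "eigen_mean (\<lambda>\<tau>. interior_deg n \<tau> m) = (53 * a n + 38 * b n + 5 * c n) / 96"
    by (simp add: eigen_mean_def a_def b_def c_def)
  \<comment> \<open>Since 96 = 53 + 38 + 5, the mean fixes constants and the deviation involves
    differences only, with 43 = 38 + 5.\<close>
  then have "a n - eigen_mean (\<lambda>\<tau>. interior_deg n \<tau> m) = 43/96 * (a n - b n) + 5/96 * (b n - c n)"
    by (simp add: field_simps)
  moreover have "\<bar>43/96 * x + 5/96 * y\<bar> \<le> k" if "\<bar>x\<bar> \<le> k" "\<bar>y\<bar> \<le> k" for x y k :: real
    using that by linarith
  note this[OF x y]
  ultimately show ?thesis unfolding a_def[symmetric] by (simp only:)
qed

section \<open>The forcing term and its geometric modes\<close>

text \<open>The coefficients count table triples by the patterns of the two copies at a joint and,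
  with each product counted as often as it occurs, sum to 3, the number of joints. No product of two
  factors among \<open>alone_deg\<close> and \<open>apart_deg\<close> occurs: a joint cut off from
  the other corners in both copies would be connected to no outer corner.\<close>

lemma eigen_mean_joints:
  "eigen_mean (\<lambda>\<tau>. joints_deg n \<tau> m) = (\<Sum>d\<le>m.
     161/240 * joined_deg n d * joined_deg n (m - d) +
     97/240 * (joined_deg n d * alone_deg n (m - d) + alone_deg n d * joined_deg n (m - d)) +
     71/160 * (joined_deg n d * paired_deg n (m - d) + paired_deg n d * joined_deg n (m - d)) +
     11/80 * (joined_deg n d * apart_deg n (m - d) + apart_deg n d * joined_deg n (m - d)) +
     11/120 * (alone_deg n d * paired_deg n (m - d) + paired_deg n d * alone_deg n (m - d)) +
     11/80 * paired_deg n d * paired_deg n (m - d) +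
     3/160 * (paired_deg n d * apart_deg n (m - d) + apart_deg n d * paired_deg n (m - d)))"
proof -
  define S where "S \<tau> d = joint_deg n \<tau> Lft Rgt d (m - d) + joint_deg n \<tau> Lft Top d (m - d) +
     joint_deg n \<tau> Rgt Top d (m - d)" for \<tau> d
  have "eigen_mean (\<lambda>\<tau>. joints_deg n \<tau> m) = (\<Sum>d\<le>m. eigen_mean (\<lambda>\<tau>. S \<tau> d))"
    unfolding eigen_mean_def off_mean_def joints_deg_def S_def[symmetric]
    by (simp add: sum.distrib sum_divide_distrib[symmetric] sum_distrib_left[symmetric])
  then show ?thesis
    unfolding S_def eigen_mean_def off_mean_def joint_deg_def expect_def mix_simps
    by (elim ssubst, intro sum.cong refl) (simp add: field_simps)
qed

text \<open>Six modes suffice. With u, v, t the powers of 1/15, 3/5, 1/25 one has t = u v; the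
  absent products are those that could give v v, v t or t t, so only 1, u, v, t, u u and u t remain.
  Since a corner has degree at most 2 inside its graph, \<open>m = 4\<close> is the largest relevant
  degree.\<close>

lemma joints_modes:
  defines "w m n \<equiv> eigen_mean (\<lambda>\<tau>. joints_deg n \<tau> m)"
  shows "w 1 n = 1089/980 * (3/5) ^ n - 407/2352 * (1/25) ^ n + 43/8820 * (1/375) ^ n"
    "w 2 n = 363/196 - 121/490 * (1/15) ^ n - 99/196 * (3/5) ^ n + 703/2352 * (1/25) ^ n
      + 11/2646 * (1/225) ^ n - 43/2940 * (1/375) ^ n"
    "w 3 n = 99/98 + 44/245 * (1/15) ^ n - 513/980 * (3/5) ^ n - 185/2352 * (1/25) ^ n
      - 11/1323 * (1/225) ^ n + 43/2940 * (1/375) ^ n"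
    "w 4 n = 27/196 + 33/490 * (1/15) ^ n - 81/980 * (3/5) ^ n - 37/784 * (1/25) ^ n
      + 11/2646 * (1/225) ^ n - 43/8820 * (1/375) ^ n"
proof -
  define u v t :: real where "u = (1/15) ^ n" and "v = (3/5) ^ n" and "t = (1/25) ^ n"
  have mult: "(1/225) ^ n = u * u" "(1/375) ^ n = u * t" "t = u * v"
    by (simp_all add: u_def v_def t_def power_mult_distrib[symmetric])
  have sums: "(\<Sum>d\<le>1. g d) = g 0 + g 1" "(\<Sum>d\<le>2. g d) = g 0 + g 1 + g 2"
    "(\<Sum>d\<le>3. g d) = g 0 + g 1 + g 2 + g 3" "(\<Sum>d\<le>4. g d) = g 0 + g 1 + g 2 + g 3 + g 4"
    for g :: "nat \<Rightarrow> real"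
    by (simp_all add: eval_nat_numeral)
  note expand = w_def eigen_mean_joints sums deg_defs u_def[symmetric] v_def[symmetric]
    t_def[symmetric] mult(1,2)
  show "w 1 n = 1089/980 * (3/5) ^ n - 407/2352 * (1/25) ^ n + 43/8820 * (1/375) ^ n"
    unfolding expand by (simp add: mult(3) algebra_simps add_divide_distrib diff_divide_distrib)
  show "w 2 n = 363/196 - 121/490 * (1/15) ^ n - 99/196 * (3/5) ^ n + 703/2352 * (1/25) ^ n
      + 11/2646 * (1/225) ^ n - 43/2940 * (1/375) ^ n"
    unfolding expand by (simp add: mult(3) algebra_simps add_divide_distrib diff_divide_distrib)
  show "w 3 n = 99/98 + 44/245 * (1/15) ^ n - 513/980 * (3/5) ^ n - 185/2352 * (1/25) ^ n
      - 11/1323 * (1/225) ^ n + 43/2940 * (1/375) ^ n"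
    unfolding expand by (simp add: mult(3) algebra_simps add_divide_distrib diff_divide_distrib)
  show "w 4 n = 27/196 + 33/490 * (1/15) ^ n - 81/980 * (3/5) ^ n - 37/784 * (1/25) ^ n
      + 11/2646 * (1/225) ^ n - 43/8820 * (1/375) ^ n"
    unfolding expand by (simp add: mult(3) algebra_simps add_divide_distrib diff_divide_distrib)
qed

section \<open>Passage to the limit\<close>

text \<open>A forcing term k x^n contributes k (3^n - x^n) / (3 - x) to the solution; the numerical
  factors are the values of 1 / (3 - x).\<close>

lemma affine_recurrence_limit:
  fixes L :: "nat \<Rightarrow> real"
  assumes "L 0 = 0" and rec: "\<And>n. L (Suc n) = 3 * L n + (k0 + k1 * (1/15) ^ n + k2 * (3/5) ^ n +
      k3 * (1/25) ^ n + k4 * (1/225) ^ n + k5 * (1/375) ^ n)"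
  shows "(\<lambda>n. L n / 3 ^ n) \<longlonglongrightarrow>
    k0 / 2 + 15/44 * k1 + 5/12 * k2 + 25/74 * k3 + 225/674 * k4 + 375/1124 * k5"
proof -
  have closed: "L n = k0 / 2 * (3 ^ n - 1 ^ n) + 15/44 * k1 * (3 ^ n - (1/15) ^ n) +
      5/12 * k2 * (3 ^ n - (3/5) ^ n) + 25/74 * k3 * (3 ^ n - (1/25) ^ n) +
      225/674 * k4 * (3 ^ n - (1/225) ^ n) + 375/1124 * k5 * (3 ^ n - (1/375) ^ n)" for n
  proof (induction n)
    case 0
    then show ?case using assms(1) by simp
  next
    case (Suc n)
    show ?case unfolding rec Suc.IH power_Suc
      by (simp add: algebra_simps add_divide_distrib diff_divide_distrib)
  qed
  have scale: "c * (3 ^ n - x ^ n) / 3 ^ n = c * (1 - (x / 3) ^ n)" for c x :: real and n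
    by (simp add: power_divide diff_divide_distrib right_diff_distrib)
  have eq: "L n / 3 ^ n = k0 / 2 * (1 - (1 / 3) ^ n) + 15/44 * k1 * (1 - (1/15 / 3) ^ n) +
      5/12 * k2 * (1 - (3/5 / 3) ^ n) + 25/74 * k3 * (1 - (1/25 / 3) ^ n) +
      225/674 * k4 * (1 - (1/225 / 3) ^ n) + 375/1124 * k5 * (1 - (1/375 / 3) ^ n)" for n
    unfolding closed add_divide_distrib by (simp only: scale)
  have "(\<lambda>n. c * (1 - x ^ n)) \<longlonglongrightarrow> c * (1 - 0)" if "0 \<le> x" "x < 1" for c x :: real
    by (intro tendsto_intros LIMSEQ_power_zero) (use that in auto)
  from this[of "1/3" "k0 / 2"] this[of "1/15 / 3" "15/44 * k1"] this[of "3/5 / 3" "5/12 * k2"]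
    this[of "1/25 / 3" "25/74 * k3"] this[of "1/225 / 3" "225/674 * k4"]
    this[of "1/375 / 3" "375/1124 * k5"]
  have "(\<lambda>n. L n / 3 ^ n) \<longlonglongrightarrow> k0 / 2 * (1 - 0) + 15/44 * k1 * (1 - 0) + 5/12 * k2 * (1 - 0) +
      25/74 * k3 * (1 - 0) + 225/674 * k4 * (1 - 0) + 375/1124 * k5 * (1 - 0)"
    unfolding eq by (intro tendsto_add) simp_all
  then show ?thesis by simp
qed

lemma interior_deg_limit:
  assumes "\<And>n. eigen_mean (\<lambda>\<tau>. joints_deg n \<tau> m) =
    k0 + k1 * (1/15) ^ n + k2 * (3/5) ^ n + k3 * (1/25) ^ n + k4 * (1/225) ^ n + k5 * (1/375) ^ n"
  shows "(\<lambda>n. interior_deg n Joined m / 3 ^ n) \<longlonglongrightarrow>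
    k0 / 2 + 15/44 * k1 + 5/12 * k2 + 25/74 * k3 + 225/674 * k4 + 375/1124 * k5"
proof -
  define L where "L n = eigen_mean (\<lambda>\<tau>. interior_deg n \<tau> m)" for n
  have "(\<lambda>n. L n / 3 ^ n) \<longlonglongrightarrow>
      k0 / 2 + 15/44 * k1 + 5/12 * k2 + 25/74 * k3 + 225/674 * k4 + 375/1124 * k5"
  proof (rule affine_recurrence_limit)
    show "L 0 = 0" by (simp add: L_def eigen_mean_def off_mean_def interior_deg_0)
  qed (simp only: L_def eigen_mean_interior_Suc assms)
  moreover have "(\<lambda>n. (interior_deg n Joined m - L n) / 3 ^ n) \<longlonglongrightarrow> 0"
  proof (rule tendsto_0_le[where K = 1])
    show "\<forall>\<^sub>F n in sequentially. norm ((interior_deg n Joined m - L n) / 3 ^ n) \<le> norm (3 * (real n * (1/3) ^ n)) * 1"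
    proof (rule always_eventually, rule allI)
      fix n
      have "\<bar>interior_deg n Joined m - L n\<bar> / 3 ^ n \<le> 3 * real n / 3 ^ n"
        by (rule divide_right_mono) (simp_all add: L_def interior_deg_close)
      then show "norm ((interior_deg n Joined m - L n) / 3 ^ n) \<le> norm (3 * (real n * (1/3) ^ n)) * 1"
        by (simp add: abs_divide abs_mult power_divide)
    qed
    show "(\<lambda>n. 3 * (real n * (1/3) ^ n)) \<longlonglongrightarrow> 0"
      by (rule tendsto_mult_right_zero) (rule powser_times_n_limit_0, simp)
  qed
  ultimately have "(\<lambda>n. L n / 3 ^ n + (interior_deg n Joined m - L n) / 3 ^ n) \<longlonglongrightarrow>
      k0 / 2 + 15/44 * k1 + 5/12 * k2 + 25/74 * k3 + 225/674 * k4 + 375/1124 * k5 + 0"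
    by (rule tendsto_add)
  moreover have "L n / 3 ^ n + (interior_deg n Joined m - L n) / 3 ^ n = interior_deg n Joined m / 3 ^ n"
    for n by (simp add: diff_divide_distrib)
  ultimately show ?thesis by (simp only: add_0_right)
qed

lemma sg_trees_eq: "sg_trees n = forests (sg_verts n) (sg_edges n) (corner n) Joined"
proof -
  have "spanning_tree (sg_verts n) (sg_edges n) T \<longleftrightarrow>
      T \<in> forests (sg_verts n) (sg_edges n) (corner n) Joined" for T
    by (rule spanning_tree_iff_Joined)
      (use finite_sg_edges finite_sg_verts sg_edges_wf corner_in in auto)
  then show ?thesis by (simp add: sg_trees_def)
qed

lemma card_side: "card (UNIV :: side set) = 3"
  by (simp add: UNIV_side)

lemma sg_phi_eq:
  "sg_phi m n = (interior_deg n Joined m + 3 * joined_deg n m) / (3 / 2 * (3 ^ n + 1))"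
proof -
  have F: "sg_F m n x = num_deg n Joined x m / num_forests n Joined" for x
    by (simp add: sg_F_def sg_f_deg_def sg_f_def sg_trees_eq num_deg_def deg_count_def num_forests_def)
  have inj: "inj (corner n)"
  proof (rule injI)
    show "i = j" if "corner n i = corner n j" for i j using that by (cases i; cases j; simp)
  qed
  have sub: "range (corner n) \<subseteq> sg_verts n" using corner_in by blast
  have "num_forests n Joined \<noteq> 0" using num_forests_pos[of n Joined] by simp
  then have "(\<Sum>x\<in>range (corner n). sg_F m n x) = 3 * joined_deg n m"
    by (simp add: sum.reindex[OF inj] F num_deg_corner card_side)
  moreover have "(\<Sum>x\<in>sg_verts n - range (corner n). sg_F m n x) = interior_deg n Joined m"
    by (simp add: interior_deg_def num_interior_def F sum_divide_distrib)
  ultimately have "(\<Sum>x\<in>sg_verts n. sg_F m n x) = interior_deg n Joined m + 3 * joined_deg n m"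
    using sum.subset_diff[OF sub finite_sg_verts, of "sg_F m n"] by simp
  then show ?thesis unfolding sg_phi_def card_sg_verts by simp
qed

lemma joined_deg_over_power: "(\<lambda>n. 3 * joined_deg n m / 3 ^ n) \<longlonglongrightarrow> 0"
proof (rule tendsto_0_le[where K = 1])
  show "\<forall>\<^sub>F n in sequentially. norm (3 * joined_deg n m / 3 ^ n) \<le> norm (3 * (1/3 :: real) ^ n) * 1"
  proof (rule always_eventually, rule allI)
    fix n
    define q :: real where "q = (1/15) ^ n"
    have "0 \<le> q" "q \<le> 1" by (simp_all add: q_def power_le_one)
    then have "\<bar>joined_deg n m\<bar> \<le> 1"
      unfolding joined_deg_def q_def[symmetric] by (auto simp: abs_le_iff)
    then have "\<bar>3 * joined_deg n m\<bar> / 3 ^ n \<le> 3 / 3 ^ n" by (intro divide_right_mono) simp_all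
    then show "norm (3 * joined_deg n m / 3 ^ n) \<le> norm (3 * (1/3 :: real) ^ n) * 1"
      by (simp add: abs_divide power_divide)
  qed
  show "(\<lambda>n. 3 * (1/3) ^ n) \<longlonglongrightarrow> (0 :: real)"
    by (rule tendsto_mult_right_zero) (rule LIMSEQ_power_zero, simp)
qed

text \<open>The factor 2/3 is the limit of 3^n over the number of vertices; the three corners
  contribute a bounded amount and vanish in the limit.\<close>

lemma sg_phi_limit:
  assumes "\<And>n. eigen_mean (\<lambda>\<tau>. joints_deg n \<tau> m) =
    k0 + k1 * (1/15) ^ n + k2 * (3/5) ^ n + k3 * (1/25) ^ n + k4 * (1/225) ^ n + k5 * (1/375) ^ n"
  shows "(\<lambda>n. sg_phi m n) \<longlonglongrightarrow>
    2/3 * (k0 / 2 + 15/44 * k1 + 5/12 * k2 + 25/74 * k3 + 225/674 * k4 + 375/1124 * k5)"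
    (is "_ \<longlonglongrightarrow> 2/3 * ?l")
proof -
  have "sg_phi m n = (interior_deg n Joined m / 3 ^ n + 3 * joined_deg n m / 3 ^ n) /
      (3/2 * (1 + (1/3) ^ n))" for n
  proof -
    have "3/2 * (1 + (1/3) ^ n) = 3/2 * (3 ^ n + 1) / (3 ^ n :: real)"
      by (simp add: power_divide field_simps)
    moreover have "x / 3 ^ n / (y / 3 ^ n) = x / y" for x y :: real by simp
    ultimately show ?thesis unfolding sg_phi_eq by (simp only: add_divide_distrib[symmetric])
  qed
  moreover have "(\<lambda>n. (interior_deg n Joined m / 3 ^ n + 3 * joined_deg n m / 3 ^ n) /
      (3/2 * (1 + (1/3) ^ n))) \<longlonglongrightarrow> (?l + 0) / (3/2 * (1 + 0))"
    by (intro tendsto_intros interior_deg_limit[OF assms] joined_deg_over_power LIMSEQ_power_zero)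
      simp_all
  ultimately show ?thesis by simp
qed

theorem mainTheorem1:
  shows "(\<lambda>n. sg_phi 1 n) \<longlonglongrightarrow> 10957 / 40464 \<and>
         (\<lambda>n. sg_phi 2 n) \<longlonglongrightarrow> 6626035 / 13636368 \<and>
         (\<lambda>n. sg_phi 3 n) \<longlonglongrightarrow> 2943139 / 13636368 \<and>
         (\<lambda>n. sg_phi 4 n) \<longlonglongrightarrow> 124895 / 4545456"
proof (intro conjI)
  show "(\<lambda>n. sg_phi 1 n) \<longlonglongrightarrow> 10957 / 40464"
    \<comment> \<open>The constant mode is 0 here: a joint of degree 1 has degree 0 in one of its
      copies, and the probability of that decays geometrically.\<close>
    by (rule tendsto_eq_rhs[OF sg_phi_limit[of 1 0 0 "1089/980" "-407/2352" 0 "43/8820"]])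
      (simp_all only: joints_modes, simp_all)
  show "(\<lambda>n. sg_phi 2 n) \<longlonglongrightarrow> 6626035 / 13636368"
    by (rule tendsto_eq_rhs[OF sg_phi_limit[of 2 "363/196" "-121/490" "-99/196" "703/2352" "11/2646" "-43/2940"]])
      (simp_all only: joints_modes, simp_all)
  show "(\<lambda>n. sg_phi 3 n) \<longlonglongrightarrow> 2943139 / 13636368"
    by (rule tendsto_eq_rhs[OF sg_phi_limit[of 3 "99/98" "44/245" "-513/980" "-185/2352" "-11/1323" "43/2940"]])
      (simp_all only: joints_modes, simp_all)
  show "(\<lambda>n. sg_phi 4 n) \<longlonglongrightarrow> 124895 / 4545456"
    by (rule tendsto_eq_rhs[OF sg_phi_limit[of 4 "27/196" "33/490" "-81/980" "-37/784" "11/2646" "-43/8820"]])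
      (simp_all only: joints_modes, simp_all)
qed

end
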